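(* For every sequence $(c_n)_{n\ge1}$ of positive reals with $c_n\to0$ there exist an ergodic dynamical system $(\Omega,\mathcal A,\mu,T)$, an increasing filtration $(\mathcal F_i)_{i\in\mathbb Z}$ of sub-$\sigma$-algebras of $\mathcal A$ with $T^{-1}\mathcal F_i=\mathcal F_{i+1}$ for all $i$, and a square integrable, zero mean, $\mathcal F_0$-measurable function $f$ on $\Omega$ such that $$\sum_{n=1}^\infty c_n\frac{\|E(S_n(f)\mid\mathcal F_0)\|_2}{n^{3/2}}<\infty,$$ but there are two subsequences $(n_k')$ and $(n_k'')$ of the positive integers along which the distributions of $S_{n_k'}(f)/\sigma_{n_k'}$ and of $S_{n_k''}(f)/\sigma_{n_k''}$ converge weakly to two different limits.
   Context: A dynamical system $(\Omega,\mathcal A,\mu,T)$ is a probability space $(\Omega,\mathcal A,\mu)$ with a bijective, bimeasurable, measure preserving map $T:\Omega\to\Omega$; it is ergodic if $A=T^{-1}A$, $A\in\mathcal A$, implies $\mu(A)\in\{0,1\}$. For a function $f$ on $\Omega$, $S_n(f)=\sum_{i=0}^{n-1} f\circ T^i$ and $\sigma_n=\|S_n(f)\|_2$ (norm in $L^2(\mu)$). *)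

theory Defs
  imports "HOL-Probability.Probability"
begin

locale dynamical_system = prob_space M for M :: "'a measure" +
  fixes T :: "'a \<Rightarrow> 'a"
  assumes T_bij: "bij_betw T (space M) (space M)"
    and T_measurable: "T \<in> measurable M M"
    and T_image_measurable: "\<And>A. A \<in> sets M \<Longrightarrow> T ` A \<in> sets M"
    and T_preserving: "\<And>A. A \<in> sets M \<Longrightarrow> emeasure M (T -` A \<inter> space M) = emeasure M A"

locale ergodic_dynamical_system = dynamical_system +
  assumes ergodic: "\<And>A. A \<in> sets M \<Longrightarrow> T -` A \<inter> space M = A \<Longrightarrow> measure M A \<in> {0, 1}"

definition birkhoff_sum :: "('a \<Rightarrow> 'a) \<Rightarrow> ('a \<Rightarrow> real) \<Rightarrow> nat \<Rightarrow> 'a \<Rightarrow> real" where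
  "birkhoff_sum T f n = (\<lambda>x. \<Sum>i<n. f ((T ^^ i) x))"

(* Meaningful for g square integrable only: the Bochner integral of a
   non-integrable function is 0. *)
definition L2_norm :: "'a measure \<Rightarrow> ('a \<Rightarrow> real) \<Rightarrow> real" where
  "L2_norm M g = sqrt (\<integral>x. (g x)\<^sup>2 \<partial>M)"

definition normalized_law :: "'a measure \<Rightarrow> ('a \<Rightarrow> 'a) \<Rightarrow> ('a \<Rightarrow> real) \<Rightarrow> nat \<Rightarrow> real measure" where
  "normalized_law M T f n =
     distr M borel (\<lambda>x. birkhoff_sum T f n x / L2_norm M (birkhoff_sum T f n))"

end

theory Submission
  imports Defs
begin

text \<open>The system is a Bernoulli shift whose coordinates are sequences of independent standardized
  variables \<open>e\<^sub>k\<close>, and \<open>f = \<Sum>\<^sub>k (s\<^sub>k / m\<^sub>k) \<Sum>\<^bsub>j < m\<^sub>k\<^esub> e\<^sub>k \<circ> T\<^sup>-\<^sup>j\<close>.  The \<open>k\<close>-th summand contributes at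
  most \<open>s\<^sub>k min n m\<^sub>k / sqrt m\<^sub>k\<close> to the norm of \<open>E(S\<^sub>n f | F\<^sub>0)\<close>.  Summed against \<open>n powr (-3/2)\<close> this
  is a multiple of \<open>s\<^sub>k\<close>, but most of the mass sits at \<open>n\<close> of order \<open>m\<^sub>k\<close>; so with the additional
  weights \<open>c n\<close> it is at most \<open>2 powr (-k)\<close> once \<open>m\<^sub>k\<close> is large, even though \<open>s\<^sub>k\<close> tends to infinity.
  As \<open>s\<^sub>k\<close> dominates \<open>s\<^sub>0 + \<dots> + s\<^bsub>k-1\<^esub>\<close>, for \<open>n\<close> between suitable \<open>n'\<^sub>k\<close> and \<open>n''\<^sub>k\<close> the normalized sum
  \<open>S\<^sub>n f / \<sigma>\<^sub>n\<close> is close in \<open>L\<^sup>2\<close> to \<open>S\<^sub>n e\<^sub>k / sqrt n\<close>.  The variable \<open>e\<^sub>k\<close> vanishes except with a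
  probability \<open>p\<^sub>k\<close> for which \<open>n'\<^sub>k p\<^sub>k\<close> tends to zero and \<open>n''\<^sub>k p\<^sub>k\<close> to infinity.  Along \<open>n'\<^sub>k\<close> the
  sums therefore vanish with probability tending to one and the limit is the point mass at \<open>0\<close>, while
  along \<open>n''\<^sub>k\<close> it is Gaussian.\<close>

section \<open>Square integrable functions\<close>

definition square_integrable :: "'a measure \<Rightarrow> ('a \<Rightarrow> real) \<Rightarrow> bool" where
  "square_integrable M g \<longleftrightarrow> g \<in> borel_measurable M \<and> integrable M (\<lambda>x. (g x)\<^sup>2)"

lemma square_integrableI [intro?]:
  "g \<in> borel_measurable M \<Longrightarrow> integrable M (\<lambda>x. (g x)\<^sup>2) \<Longrightarrow> square_integrable M g"
  by (simp add: square_integrable_def)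

lemma square_integrable_measurable [measurable_dest]:
  "square_integrable M g \<Longrightarrow> g \<in> borel_measurable M"
  by (simp add: square_integrable_def)

lemma square_integrable_mult:
  assumes f: "square_integrable M f" and g: "square_integrable M g"
  shows "integrable M (\<lambda>x. f x * g x)"
proof (rule Bochner_Integration.integrable_bound)
  show "integrable M (\<lambda>x. (f x)\<^sup>2 + (g x)\<^sup>2)"
    using f g by (simp add: square_integrable_def)
  show "(\<lambda>x. f x * g x) \<in> borel_measurable M"
    using f g by measurable
  have "\<bar>a * b\<bar> \<le> a\<^sup>2 + b\<^sup>2" for a b :: real
  proof -
    have "2 * \<bar>a\<bar> * \<bar>b\<bar> \<le> a\<^sup>2 + b\<^sup>2"
      using sum_squares_bound[of "\<bar>a\<bar>" "\<bar>b\<bar>"] by simp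
    moreover have "0 \<le> \<bar>a\<bar> * \<bar>b\<bar>" by simp
    ultimately show ?thesis by (simp only: abs_mult)
  qed
  then show "AE x in M. norm (f x * g x) \<le> norm ((f x)\<^sup>2 + (g x)\<^sup>2)"
    by (auto intro: order_trans[OF _ abs_ge_self])
qed

lemma square_integrable_add [intro]:
  assumes f: "square_integrable M f" and g: "square_integrable M g"
  shows "square_integrable M (\<lambda>x. f x + g x)"
proof
  show "(\<lambda>x. f x + g x) \<in> borel_measurable M" using f g by measurable
  show "integrable M (\<lambda>x. (f x + g x)\<^sup>2)"
    using f g square_integrable_mult[OF f g]
    by (simp add: power2_sum square_integrable_def mult.assoc)
qed

lemma square_integrable_cmult [intro]:
  "square_integrable M f \<Longrightarrow> square_integrable M (\<lambda>x. a * f x)"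
  by (auto simp: square_integrable_def power_mult_distrib)

lemma square_integrable_divide [intro]:
  "square_integrable M f \<Longrightarrow> square_integrable M (\<lambda>x. f x / a)"
  using square_integrable_cmult[of M f "1 / a"] by simp

lemma square_integrable_diff [intro]:
  "square_integrable M f \<Longrightarrow> square_integrable M g \<Longrightarrow> square_integrable M (\<lambda>x. f x - g x)"
  using square_integrable_add[of M f "\<lambda>x. -1 * g x"] square_integrable_cmult[of M g "-1"] by simp

lemma square_integrable_zero [simp]: "square_integrable M (\<lambda>x. 0)"
  by (simp add: square_integrable_def)

lemma square_integrable_sum [intro]:
  "(\<And>i. i \<in> I \<Longrightarrow> square_integrable M (g i)) \<Longrightarrow> square_integrable M (\<lambda>x. \<Sum>i\<in>I. g i x)"
  by (induction I rule: infinite_finite_induct) auto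

lemma L2_norm_nonneg [simp]: "0 \<le> L2_norm M g"
  by (simp add: L2_norm_def)

lemma L2_norm_sq: "(L2_norm M g)\<^sup>2 = (\<integral>x. (g x)\<^sup>2 \<partial>M)"
  by (simp add: L2_norm_def)

lemma L2_norm_zero [simp]: "L2_norm M (\<lambda>x. 0) = 0"
  by (simp add: L2_norm_def)

lemma L2_norm_cmult: "L2_norm M (\<lambda>x. a * g x) = \<bar>a\<bar> * L2_norm M g"
  by (simp add: L2_norm_def power_mult_distrib real_sqrt_mult)

lemma L2_norm_minus_commute: "L2_norm M (\<lambda>x. f x - g x) = L2_norm M (\<lambda>x. g x - f x)"
  by (simp add: L2_norm_def power2_commute)

lemma L2_norm_divide: "L2_norm M (\<lambda>x. g x / a) = L2_norm M g / \<bar>a\<bar>"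
  using L2_norm_cmult[of M "1 / a" g] by simp

lemma L2_norm_cong_AE:
  assumes "f \<in> borel_measurable M" "g \<in> borel_measurable M" "AE x in M. f x = g x"
  shows "L2_norm M f = L2_norm M g"
  unfolding L2_norm_def using assms by (intro arg_cong[where f=sqrt] integral_cong_AE) auto

text \<open>The Cauchy-Schwarz inequality, read off from the nonnegativity of the quadratic form in
  \<open>a\<close> and \<open>b\<close> given by the integral of the square of
  \<open>a * f + b * g\<close>.\<close>

lemma abs_integral_mult_le_L2_norm:
  assumes f: "square_integrable M f" and g: "square_integrable M g"
  shows "\<bar>\<integral>x. f x * g x \<partial>M\<bar> \<le> L2_norm M f * L2_norm M g"
proof -
  let ?I = "\<integral>x. f x * g x \<partial>M"
  have int: "integrable M (\<lambda>x. (f x)\<^sup>2)" "integrable M (\<lambda>x. (g x)\<^sup>2)" "integrable M (\<lambda>x. f x * g x)"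
    using f g square_integrable_mult[OF f g] by (auto simp: square_integrable_def)
  have quad: "0 \<le> (L2_norm M f)\<^sup>2 * a\<^sup>2 + 2 * a * b * ?I + (L2_norm M g)\<^sup>2 * b\<^sup>2" for a b
  proof -
    have "0 \<le> (\<integral>x. (a * f x + b * g x)\<^sup>2 \<partial>M)" by simp
    also have "(\<lambda>x. (a * f x + b * g x)\<^sup>2)
        = (\<lambda>x. (a\<^sup>2 * (f x)\<^sup>2 + b\<^sup>2 * (g x)\<^sup>2) + (2 * a * b) * (f x * g x))"
      by (auto simp: power2_eq_square algebra_simps)
    also have "(\<integral>x. \<dots> x \<partial>M) = (L2_norm M f)\<^sup>2 * a\<^sup>2 + 2 * a * b * ?I + (L2_norm M g)\<^sup>2 * b\<^sup>2"
      using int by (simp add: L2_norm_sq)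
    finally show ?thesis .
  qed
  define A where "A = (L2_norm M f)\<^sup>2"
  define B where "B = (L2_norm M g)\<^sup>2"
  have nn: "0 \<le> A" "0 \<le> B" by (auto simp: A_def B_def)
  have q: "0 \<le> A * a\<^sup>2 + 2 * a * b * ?I + B * b\<^sup>2" for a b
    using quad by (simp add: A_def B_def)
  have "?I\<^sup>2 \<le> A * B"
  proof (cases "B = 0")
    case True
    have "?I = 0"
    proof (rule ccontr)
      assume "?I \<noteq> 0"
      \<comment> \<open>With \<open>B = 0\<close> the form is affine in \<open>b\<close> for
        \<open>a = 1\<close>. This \<open>b\<close> makes its value
        \<open>A - (A + 1) = -1\<close>.\<close>
      with q[of 1 "- (A + 1) / (2 * ?I)"] True nn show False by (simp add: field_simps)
    qed
    with True show ?thesis by simp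
  next
    case False
    \<comment> \<open>The choice \<open>a = B\<close>, \<open>b = - ?I\<close> minimises the form up
      to scaling and leaves \<open>B\<close> times the discriminant.\<close>
    have "0 \<le> A * B\<^sup>2 + 2 * B * (- ?I) * ?I + B * (- ?I)\<^sup>2" by (rule q)
    then have "0 \<le> B * (A * B - ?I\<^sup>2)" by (simp add: power2_eq_square algebra_simps)
    with False nn show ?thesis by (simp add: zero_le_mult_iff)
  qed
  then have "?I\<^sup>2 \<le> (L2_norm M f * L2_norm M g)\<^sup>2" by (simp add: A_def B_def power_mult_distrib)
  then show ?thesis using abs_le_square_iff[of ?I "L2_norm M f * L2_norm M g"] by simp
qed

lemma L2_norm_add_le:
  assumes f: "square_integrable M f" and g: "square_integrable M g"
  shows "L2_norm M (\<lambda>x. f x + g x) \<le> L2_norm M f + L2_norm M g"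
proof (rule power2_le_imp_le)
  have "(L2_norm M (\<lambda>x. f x + g x))\<^sup>2 = (\<integral>x. (f x)\<^sup>2 + (g x)\<^sup>2 + 2 * (f x * g x) \<partial>M)"
    by (simp add: L2_norm_sq power2_sum mult.assoc)
  also have "\<dots> = (L2_norm M f)\<^sup>2 + (L2_norm M g)\<^sup>2 + 2 * (\<integral>x. f x * g x \<partial>M)"
    using f g square_integrable_mult[OF f g] by (simp add: L2_norm_sq square_integrable_def)
  also have "\<dots> \<le> (L2_norm M f + L2_norm M g)\<^sup>2"
    using abs_integral_mult_le_L2_norm[OF f g] by (simp add: power2_sum)
  finally show "(L2_norm M (\<lambda>x. f x + g x))\<^sup>2 \<le> (L2_norm M f + L2_norm M g)\<^sup>2" .
qed simp

lemma L2_norm_diff_le: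
  assumes f: "square_integrable M f" and g: "square_integrable M g"
  shows "L2_norm M (\<lambda>x. f x - g x) \<le> L2_norm M f + L2_norm M g"
  using L2_norm_add_le[OF f square_integrable_cmult[OF g, of "-1"]] L2_norm_cmult[of M "-1" g]
  by simp

lemma L2_norm_sum_le:
  assumes "\<And>i. i \<in> I \<Longrightarrow> square_integrable M (g i)"
  shows "L2_norm M (\<lambda>x. \<Sum>i\<in>I. g i x) \<le> (\<Sum>i\<in>I. L2_norm M (g i))"
  using assms
proof (induction I rule: infinite_finite_induct)
  case (insert i I)
  have "L2_norm M (\<lambda>x. g i x + (\<Sum>i\<in>I. g i x)) \<le> L2_norm M (g i) + L2_norm M (\<lambda>x. \<Sum>i\<in>I. g i x)"
    using insert.prems by (intro L2_norm_add_le) auto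
  also have "\<dots> \<le> L2_norm M (g i) + (\<Sum>i\<in>I. L2_norm M (g i))"
    using insert by auto
  finally show ?case using insert.hyps by simp
qed auto

lemma abs_L2_norm_diff_le:
  assumes f: "square_integrable M f" and g: "square_integrable M g"
  shows "\<bar>L2_norm M f - L2_norm M g\<bar> \<le> L2_norm M (\<lambda>x. f x - g x)"
  using L2_norm_add_le[OF square_integrable_diff[OF f g] g]
    L2_norm_add_le[OF square_integrable_diff[OF g f] f]
  by (simp add: L2_norm_minus_commute[of M f g])

lemma L2_norm_compose:
  assumes "h \<in> measurable M M'" "distr M M' h = M'" "g \<in> borel_measurable M'"
  shows "L2_norm M (\<lambda>x. g (h x)) = L2_norm M' g"
  using integral_distr[of h M M' "\<lambda>x. (g x)\<^sup>2"] assms by (simp add: L2_norm_def)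

lemma square_integrable_compose:
  assumes "h \<in> measurable M M'" "distr M M' h = M'" "square_integrable M' g"
  shows "square_integrable M (\<lambda>x. g (h x))"
  using assms integrable_distr_eq[of h M M' "\<lambda>x. (g x)\<^sup>2"] measurable_compose[of h M M' g borel]
  by (auto simp: square_integrable_def)

section \<open>Series, conditional expectations and characteristic functions in L2 of a probability
  space\<close>

context prob_space
begin

lemma square_integrable_integrable:
  "square_integrable M g \<Longrightarrow> integrable M g"
  by (auto simp: square_integrable_def intro: square_integrable_imp_integrable)

lemma square_integrable_const [simp]: "square_integrable M (\<lambda>x. a)"
  by (simp add: square_integrable_def)

lemma integral_abs_le_L2_norm:
  assumes g: "square_integrable M g"
  shows "(\<integral>x. \<bar>g x\<bar> \<partial>M) \<le> L2_norm M g"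
proof -
  have "square_integrable M (\<lambda>x. \<bar>g x\<bar>)"
    using g by (auto simp: square_integrable_def)
  from abs_integral_mult_le_L2_norm[OF this square_integrable_const[of 1]]
  show ?thesis by (simp add: L2_norm_def prob_space)
qed

text \<open>Since L1 norms are at most L2 norms, the series of absolute values has finite integral
  and hence converges almost everywhere. The squared partial sums then converge almost everywhere to
  the square of the sum, and Fatou's lemma carries over the uniform bound that the triangle
  inequality gives for the partial sums. Points of divergence, where the infinite sum has a default
  value, form a null set.\<close>

lemma
  fixes g :: "nat \<Rightarrow> 'a \<Rightarrow> real"
  assumes g: "\<And>k. square_integrable M (g k)" and sm: "summable (\<lambda>k. L2_norm M (g k))"
  shows AE_summable_of_L2_norm: "AE x in M. summable (\<lambda>k. g k x)"
    and square_integrable_suminf: "square_integrable M (\<lambda>x. \<Sum>k. g k x)"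
    and L2_norm_suminf_le: "L2_norm M (\<lambda>x. \<Sum>k. g k x) \<le> (\<Sum>k. L2_norm M (g k))"
proof -
  have [measurable]: "g k \<in> borel_measurable M" for k
    using g by (rule square_integrable_measurable)
  let ?C = "\<Sum>k. L2_norm M (g k)"
  have C: "0 \<le> ?C" by (intro suminf_nonneg sm) simp
  have "(\<integral>\<^sup>+x. (\<Sum>k. ennreal \<bar>g k x\<bar>) \<partial>M) = (\<Sum>k. \<integral>\<^sup>+x. ennreal \<bar>g k x\<bar> \<partial>M)"
    by (intro nn_integral_suminf) simp
  also have "\<dots> \<le> (\<Sum>k. ennreal (L2_norm M (g k)))"
  proof (intro suminf_le)
    fix k
    have "(\<integral>\<^sup>+x. ennreal \<bar>g k x\<bar> \<partial>M) = ennreal (\<integral>x. \<bar>g k x\<bar> \<partial>M)"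
      by (intro nn_integral_eq_integral integrable_abs square_integrable_integrable g) simp
    then show "(\<integral>\<^sup>+x. ennreal \<bar>g k x\<bar> \<partial>M) \<le> ennreal (L2_norm M (g k))"
      using integral_abs_le_L2_norm[OF g] by (simp add: ennreal_leI)
  qed auto
  also have "\<dots> = ennreal ?C" by (rule suminf_ennreal2[OF _ sm]) simp
  finally have "(\<integral>\<^sup>+x. (\<Sum>k. ennreal \<bar>g k x\<bar>) \<partial>M) \<noteq> \<infinity>"
    by (metis ennreal_less_top infinity_ennreal_def neq_top_trans order_less_irrefl)
  then have "AE x in M. (\<Sum>k. ennreal \<bar>g k x\<bar>) \<noteq> \<infinity>"
    by (intro nn_integral_noteq_infinite) auto
  then show ae: "AE x in M. summable (\<lambda>k. g k x)"
  proof eventually_elim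
    case (elim x)
    have "summable (\<lambda>k. \<bar>g k x\<bar>)"
      by (rule summable_suminf_not_top) (use elim in auto)
    then show ?case by (rule summable_rabs_cancel)
  qed
  have fin: "(\<integral>\<^sup>+x. ennreal ((\<Sum>k<n. g k x)\<^sup>2) \<partial>M) \<le> ennreal (?C\<^sup>2)" for n
  proof -
    have si: "square_integrable M (\<lambda>x. \<Sum>k<n. g k x)" using g by auto
    then have "(\<integral>\<^sup>+x. ennreal ((\<Sum>k<n. g k x)\<^sup>2) \<partial>M) = ennreal ((L2_norm M (\<lambda>x. \<Sum>k<n. g k x))\<^sup>2)"
      unfolding L2_norm_sq by (intro nn_integral_eq_integral) (auto simp: square_integrable_def)
    also have "\<dots> \<le> ennreal (?C\<^sup>2)"
    proof (intro ennreal_leI power_mono)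
      have "L2_norm M (\<lambda>x. \<Sum>k<n. g k x) \<le> (\<Sum>k<n. L2_norm M (g k))"
        using g by (intro L2_norm_sum_le)
      also have "\<dots> \<le> ?C" by (intro sum_le_suminf sm) auto
      finally show "L2_norm M (\<lambda>x. \<Sum>k<n. g k x) \<le> ?C" .
    qed simp
    finally show ?thesis .
  qed
  have "(\<integral>\<^sup>+x. ennreal ((\<Sum>k. g k x)\<^sup>2) \<partial>M)
      = (\<integral>\<^sup>+x. liminf (\<lambda>n. ennreal ((\<Sum>k<n. g k x)\<^sup>2)) \<partial>M)"
    using ae
  proof (intro nn_integral_cong_AE, eventually_elim)
    case (elim x)
    from summable_LIMSEQ[OF elim(2)] have "(\<lambda>n. \<Sum>k<n. g k x) \<longlonglongrightarrow> (\<Sum>k. g k x)" .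
    then have "(\<lambda>n. ennreal ((\<Sum>k<n. g k x)\<^sup>2)) \<longlonglongrightarrow> ennreal ((\<Sum>k. g k x)\<^sup>2)"
      by (intro tendsto_intros)
    then show ?case by (intro lim_imp_Liminf[symmetric]) auto
  qed
  also have "\<dots> \<le> liminf (\<lambda>n. \<integral>\<^sup>+x. ennreal ((\<Sum>k<n. g k x)\<^sup>2) \<partial>M)"
    by (intro nn_integral_liminf) auto
  also have "\<dots> \<le> liminf (\<lambda>n. ennreal (?C\<^sup>2))"
    by (intro Liminf_mono always_eventually allI fin)
  also have "\<dots> = ennreal (?C\<^sup>2)" by (simp add: Liminf_const)
  finally have le: "(\<integral>\<^sup>+x. ennreal ((\<Sum>k. g k x)\<^sup>2) \<partial>M) \<le> ennreal (?C\<^sup>2)" .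
  show si: "square_integrable M (\<lambda>x. \<Sum>k. g k x)"
  proof
    show "integrable M (\<lambda>x. (\<Sum>k. g k x)\<^sup>2)"
      using le by (intro integrableI_bounded) (auto simp: top_unique less_top[symmetric])
  qed measurable
  have "ennreal ((L2_norm M (\<lambda>x. \<Sum>k. g k x))\<^sup>2) = (\<integral>\<^sup>+x. ennreal ((\<Sum>k. g k x)\<^sup>2) \<partial>M)"
    unfolding L2_norm_sq using si
    by (intro nn_integral_eq_integral[symmetric]) (auto simp: square_integrable_def)
  with le have "ennreal ((L2_norm M (\<lambda>x. \<Sum>k. g k x))\<^sup>2) \<le> ennreal (?C\<^sup>2)" by (simp only:)
  then have "(L2_norm M (\<lambda>x. \<Sum>k. g k x))\<^sup>2 \<le> ?C\<^sup>2" by simp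
  then show "L2_norm M (\<lambda>x. \<Sum>k. g k x) \<le> ?C" using C by (rule power2_le_imp_le)
qed

text \<open>Conditional Jensen inequality for the square, followed by integration; the integral of a
  conditional expectation is that of the original function.\<close>

lemma
  assumes F: "subalgebra M F" and g: "square_integrable M g"
  shows square_integrable_real_cond_exp: "square_integrable M (real_cond_exp M F g)"
    and L2_norm_real_cond_exp_le: "L2_norm M (real_cond_exp M F g) \<le> L2_norm M g"
proof -
  interpret finite_measure_subalgebra M F by unfold_locales (rule F)
  have int: "integrable M (\<lambda>x. (g x)\<^sup>2)" and gi: "integrable M g"
    using g square_integrable_integrable[OF g] by (auto simp: square_integrable_def)
  have "convex_on UNIV (\<lambda>x::real. x\<^sup>2)" by (rule convex_power2)
  then have jensen: "AE x in M. (real_cond_exp M F g x)\<^sup>2 \<le> real_cond_exp M F (\<lambda>x. (g x)\<^sup>2) x"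
    using real_cond_exp_jensens_inequality(2)[of g UNIV _ _ "\<lambda>x. x\<^sup>2"] int gi by auto
  have int': "integrable M (real_cond_exp M F (\<lambda>x. (g x)\<^sup>2))"
    using int by (rule real_cond_exp_int)
  have m: "real_cond_exp M F g \<in> borel_measurable M" by simp
  show si: "square_integrable M (real_cond_exp M F g)"
  proof
    show "integrable M (\<lambda>x. (real_cond_exp M F g x)\<^sup>2)"
      by (rule Bochner_Integration.integrable_bound[OF int']) (use jensen m in auto)
  qed (rule m)
  have "(\<integral>x. (real_cond_exp M F g x)\<^sup>2 \<partial>M) \<le> (\<integral>x. real_cond_exp M F (\<lambda>x. (g x)\<^sup>2) x \<partial>M)"
    using si jensen int' by (intro integral_mono_AE) (auto simp: square_integrable_def)
  also have "\<dots> = (\<integral>x. (g x)\<^sup>2 \<partial>M)" using int by (rule real_cond_exp_int)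
  finally show "L2_norm M (real_cond_exp M F g) \<le> L2_norm M g" by (simp add: L2_norm_def)
qed

text \<open>The map sending \<open>a\<close> to \<open>iexp (t * a)\<close> is Lipschitz with
  constant \<open>\<bar>t\<bar>\<close>, and the L1 distance is at most the L2 distance. This lets a
  normalized sum be replaced by an L2 approximation inside its characteristic function.\<close>

lemma norm_char_diff_le_L2_norm:
  assumes X: "square_integrable M X" and Y: "square_integrable M Y"
  shows "cmod (char (distr M borel X) t - char (distr M borel Y) t)
    \<le> \<bar>t\<bar> * L2_norm M (\<lambda>x. X x - Y x)"
proof -
  have [measurable]: "X \<in> borel_measurable M" "Y \<in> borel_measurable M"
    using X Y by (auto dest: square_integrable_measurable)
  have bd: "cmod (iexp (t * a) - iexp (t * b)) \<le> \<bar>t\<bar> * \<bar>a - b\<bar>" for a b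
  proof -
    have "iexp (t * a) - iexp (t * b) = iexp (t * b) * (iexp (t * (a - b)) - 1)"
      by (simp add: algebra_simps flip: exp_add)
    then have "cmod (iexp (t * a) - iexp (t * b)) = cmod (iexp (t * (a - b)) - 1)"
      by (simp only: norm_mult norm_exp_i_times mult_1)
    also have "\<dots> \<le> \<bar>t * (a - b)\<bar>"
      using iexp_approx1[of "t * (a - b)" 0] by simp
    finally show ?thesis by (simp add: abs_mult)
  qed
  have int: "integrable M (\<lambda>x. iexp (t * X x))" "integrable M (\<lambda>x. iexp (t * Y x))"
    by (auto intro!: integrable_iexp)
  have "char (distr M borel X) t - char (distr M borel Y) t
      = (\<integral>x. iexp (t * X x) - iexp (t * Y x) \<partial>M)"
    using int by (simp add: char_def integral_distr)
  also have "cmod \<dots> \<le> (\<integral>x. cmod (iexp (t * X x) - iexp (t * Y x)) \<partial>M)"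
    by (rule integral_norm_bound)
  also have "\<dots> \<le> (\<integral>x. \<bar>t\<bar> * \<bar>X x - Y x\<bar> \<partial>M)"
  proof (intro integral_mono bd)
    show "integrable M (\<lambda>x. cmod (iexp (t * X x) - iexp (t * Y x)))"
      by (intro integrable_norm Bochner_Integration.integrable_diff int)
    show "integrable M (\<lambda>x. \<bar>t\<bar> * \<bar>X x - Y x\<bar>)"
      using square_integrable_integrable[OF square_integrable_diff[OF X Y]] by auto
  qed
  also have "\<dots> = \<bar>t\<bar> * (\<integral>x. \<bar>X x - Y x\<bar> \<partial>M)" by simp
  also have "\<dots> \<le> \<bar>t\<bar> * L2_norm M (\<lambda>x. X x - Y x)"
    by (intro mult_left_mono integral_abs_le_L2_norm square_integrable_diff X Y) simp
  finally show ?thesis .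
qed

end

section \<open>Bernoulli shifts\<close>

text \<open>In the applications \<open>u n A\<close> is the measure of the intersection of
  \<open>A\<close> with a set depending on \<open>n\<close>, or of a fixed set with a preimage of
  \<open>A\<close>, and \<open>q\<close> is the measure of the other set. For each \<open>n\<close>
  it is a finite measure dominated by \<open>M\<close>, so the sets with the asserted limit form a
  Dynkin system.\<close>

lemma Dynkin_tendsto_product:
  fixes u :: "nat \<Rightarrow> 'a set \<Rightarrow> real"
  assumes M: "prob_space M" and G: "Int_stable G" "G \<subseteq> Pow (space M)" "sets M = sigma_sets (space M) G"
    and u_le: "\<And>n A. A \<in> sets M \<Longrightarrow> 0 \<le> u n A \<and> u n A \<le> measure M A"
    and u_compl: "\<And>n A. A \<in> sets M \<Longrightarrow> u n (space M - A) = u n (space M) - u n A"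
    and u_union: "\<And>n A. range A \<subseteq> sets M \<Longrightarrow> disjoint_family A \<Longrightarrow> (\<lambda>i. u n (A i)) sums u n (\<Union>i. A i)"
    and space: "(\<lambda>n. u n (space M)) \<longlonglongrightarrow> q"
    and basic: "\<And>A. A \<in> G \<Longrightarrow> (\<lambda>n. u n A) \<longlonglongrightarrow> measure M A * q"
    and A: "A \<in> sets M"
  shows "(\<lambda>n. u n A) \<longlonglongrightarrow> measure M A * q"
proof -
  interpret prob_space M by (rule M)
  from A show ?thesis
    unfolding G(3)
  proof (induction rule: sigma_sets_induct_disjoint[OF G(1,2), consumes 1, case_names basic empty compl union])
    case (basic A)
    then show ?case by (rule assms)
  next
    case empty
    have "u n {} = 0" for n using u_le[of "{}" n] by simp
    then show ?case by simp
  next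
    case (compl A)
    then have "A \<in> sets M" by (simp add: G(3))
    then show ?case
      using tendsto_diff[OF space compl(2)] by (simp add: u_compl prob_compl left_diff_distrib)
  next
    case (union A)
    then have ev: "range A \<subseteq> sets M" by (simp add: G(3))
    have m: "(\<lambda>i. measure M (A i)) sums measure M (\<Union>i. A i)"
      by (rule finite_measure_UNION[OF ev union(1)])
    \<comment> \<open>Limit and sum are interchanged by dominated convergence for series, with the
      summable majorant \<open>measure M (A i)\<close>.\<close>
    have "(\<lambda>n. \<Sum>i. u n (A i)) \<longlonglongrightarrow> (\<Sum>i. measure M (A i) * q)"
    proof (rule tannerys_theorem[THEN conjunct2, THEN conjunct2])
      show "eventually (\<lambda>(k, n). norm (u n (A k)) \<le> measure M (A k)) (at_top \<times>\<^sub>F sequentially)"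
        using u_le ev by (intro always_eventually) (auto simp: range_subsetD)
      show "summable (\<lambda>i. measure M (A i))" using m by (rule sums_summable)
    qed (use union(3) in auto)
    moreover have "(\<Sum>i. u n (A i)) = u n (\<Union>i. A i)" for n
      using sums_unique[OF u_union[OF ev union(1)]] by simp
    moreover have "(\<Sum>i. measure M (A i) * q) = measure M (\<Union>i. A i) * q"
      using sums_unique[OF sums_mult2[OF m]] by simp
    ultimately show ?case by simp
  qed
qed

text \<open>For an invariant set paired with itself the mixing sequence is constant, so its measure
  equals its own square.\<close>

lemma (in dynamical_system) ergodicI_mixing:
  assumes mixing: "\<And>A B. A \<in> sets M \<Longrightarrow> B \<in> sets M \<Longrightarrow>
    (\<lambda>n. measure M (A \<inter> ((T ^^ n) -` B \<inter> space M))) \<longlonglongrightarrow> measure M A * measure M B"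
  shows "ergodic_dynamical_system M T"
proof
  fix A assume A: "A \<in> sets M" and inv: "T -` A \<inter> space M = A"
  have "(T ^^ n) -` A \<inter> space M = A" for n
  proof (induction n)
    case 0
    then show ?case using sets.sets_into_space[OF A] by auto
  next
    case (Suc n)
    have T: "T x \<in> space M" if "x \<in> space M" for x
      using T_measurable that by (rule measurable_space)
    have "(T ^^ Suc n) -` A \<inter> space M = T -` ((T ^^ n) -` A \<inter> space M) \<inter> space M"
      by (auto simp: funpow_Suc_right T simp del: funpow.simps)
    then show ?case by (simp only: Suc inv)
  qed
  then have "measure M A * measure M A = measure M A"
    using mixing[OF A A] by (simp add: LIMSEQ_const_iff)
  then show "measure M A \<in> {0, 1}" by auto
qed

section \<open>The two-sided shift and its mixing property\<close>

locale bernoulli_shift = N: prob_space N for N :: "'b measure" +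
  assumes space_N [simp]: "space N = UNIV"
begin

definition M :: "(int \<Rightarrow> 'b) measure" where
  "M = PiM UNIV (\<lambda>_. N)"

definition T :: "(int \<Rightarrow> 'b) \<Rightarrow> int \<Rightarrow> 'b" where
  "T x = (\<lambda>i. x (i + 1))"

text \<open>A sub-sigma-algebra has to live on the whole space of \<open>M\<close>. Therefore the
  past is generated by preimages under the coordinates up to \<open>i\<close>, and is not taken as a
  product measure over \<open>{..i}\<close>.\<close>

definition past :: "int \<Rightarrow> (int \<Rightarrow> 'b) measure" where
  "past i = sigma UNIV {(\<lambda>x. x j) -` A | j A. j \<le> i \<and> A \<in> sets N}"

sublocale P: product_prob_space "\<lambda>_::int. N" UNIV ..

sublocale prob_space M
  unfolding M_def by (rule prob_space_PiM) unfold_locales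

lemma space_M [simp]: "space M = UNIV"
  by (simp add: M_def space_PiM)

lemma measurable_coordinate [measurable]: "(\<lambda>x. x i) \<in> measurable M N"
  unfolding M_def by measurable

lemma distr_coordinate: "distr M N (\<lambda>x. x i) = N"
  unfolding M_def by (rule P.PiM_component) simp

lemma funpow_T: "(T ^^ n) x i = x (i + int n)"
  by (induction n arbitrary: x i) (simp_all add: T_def algebra_simps)

lemma measurable_shift [measurable]: "(\<lambda>x i. x (i + k)) \<in> measurable M M"
  unfolding M_def by (rule measurable_PiM_single') (auto simp: space_PiM)

lemma distr_shift: "distr M M (\<lambda>x i. x (i + k)) = M"
  using distr_PiM_reindex[of UNIV "\<lambda>_. N" "\<lambda>i::int. i + k" UNIV] N.prob_space_axioms
  by (simp add: M_def restrict_UNIV inj_def)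

lemma T_eq: "T = (\<lambda>x i. x (i + 1))"
  by (simp add: T_def fun_eq_iff)

lemma funpow_T_eq: "T ^^ n = (\<lambda>x i. x (i + int n))"
  by (simp add: funpow_T fun_eq_iff)

lemma bij_T: "bij T"
  by (rule bij_betw_byWitness[where f' = "\<lambda>x i. x (i - 1)"]) (auto simp: T_def)

sublocale D: dynamical_system M T
proof
  show "bij_betw T (space M) (space M)" using bij_T by simp
  show "T \<in> measurable M M" unfolding T_eq by measurable
  show "T ` A \<in> sets M" if "A \<in> sets M" for A
  proof -
    have "T ` A = (\<lambda>x i. x (i + (-1))) -` A"
    proof safe
      fix x assume "(\<lambda>i. x (i + (-1))) \<in> A"
      then show "x \<in> T ` A" by (rule rev_image_eqI) (simp add: T_def)
    qed (simp add: T_def)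
    then show ?thesis using measurable_sets[OF measurable_shift[of "-1"] that] by simp
  qed
  show "emeasure M (T -` A \<inter> space M) = emeasure M A" if "A \<in> sets M" for A
    using emeasure_distr[OF measurable_shift[of 1] that] by (simp add: distr_shift T_eq)
qed

definition rectangles :: "(int \<Rightarrow> 'b) set set" where
  "rectangles = {{x. \<forall>i\<in>J. x i \<in> X i} | J X. finite J \<and> (\<forall>i. X i \<in> sets N)}"

lemma measure_rectangle:
  "finite J \<Longrightarrow> (\<And>i. i \<in> J \<Longrightarrow> X i \<in> sets N) \<Longrightarrow>
    measure M {x. \<forall>i\<in>J. x i \<in> X i} = (\<Prod>i\<in>J. measure N (X i))"
  using P.emeasure_PiM_Collect[of J X]
  by (simp add: M_def[symmetric] emeasure_eq_measure N.emeasure_eq_measure prod_ennreal prod_nonneg)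

lemma Int_stable_rectangles: "Int_stable rectangles"
proof (rule Int_stableI)
  fix A B assume "A \<in> rectangles" "B \<in> rectangles"
  then obtain J X K Y where A: "A = {x. \<forall>i\<in>J. x i \<in> X i}" "finite J" "\<And>i. X i \<in> sets N"
    and B: "B = {x. \<forall>i\<in>K. x i \<in> Y i}" "finite K" "\<And>i. Y i \<in> sets N"
    by (auto simp: rectangles_def)
  define Z where "Z i = (if i \<in> J then X i else UNIV) \<inter> (if i \<in> K then Y i else UNIV)" for i
  have "A \<inter> B = {x. \<forall>i\<in>J \<union> K. x i \<in> Z i}"
    by (auto simp: A B Z_def split: if_splits)
  moreover have "Z i \<in> sets N" for i
    using A(3) B(3) sets.top[of N] unfolding Z_def by (intro sets.Int) auto
  moreover have "finite (J \<union> K)" using A(2) B(2) by simp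
  ultimately show "A \<inter> B \<in> rectangles" unfolding rectangles_def by blast
qed

lemma sets_M: "sets M = sigma_sets (space M) rectangles"
proof
  have "rectangles \<subseteq> sets M"
  proof
    fix A assume "A \<in> rectangles"
    then obtain J X where A: "A = {x. \<forall>i\<in>J. x i \<in> X i}" and J: "finite J" and X: "\<And>i. X i \<in> sets N"
      by (auto simp: rectangles_def)
    have "{x \<in> space M. \<forall>i\<in>J. x i \<in> X i} \<in> sets M"
    proof (rule sets.sets_Collect_finite_All[OF _ J])
      show "{x \<in> space M. x i \<in> X i} \<in> sets M" for i
        using measurable_sets[OF measurable_coordinate X] by (simp add: vimage_def)
    qed
    then show "A \<in> sets M" by (simp add: A)
  qed
  then show "sigma_sets (space M) rectangles \<subseteq> sets M" by (rule sets.sigma_sets_subset)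
  have "sets M = sigma_sets UNIV {{x. x i \<in> A} | i A. A \<in> sets N}"
    unfolding M_def sets_PiM_single by simp
  also have "\<dots> \<subseteq> sigma_sets UNIV rectangles"
  proof (rule sigma_sets_mono', safe)
    fix i A assume "A \<in> sets N"
    then show "{x. x i \<in> A} \<in> rectangles"
      unfolding rectangles_def by (intro CollectI exI[of _ "{i}"] exI[of _ "\<lambda>_. A"]) auto
  qed
  finally show "sets M \<subseteq> sigma_sets (space M) rectangles" by simp
qed

text \<open>As soon as \<open>n\<close> exceeds all differences \<open>i - j\<close> with
  \<open>i \<in> J\<close> and \<open>j \<in> K\<close>, the translate of \<open>K\<close> by
  \<open>n\<close> is disjoint from \<open>J\<close>. The intersection is then a rectangle over the
  disjoint union, and its measure is exactly the product, so the sequence is eventually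
  constant.\<close>

lemma mixing_rectangles:
  assumes A: "A \<in> rectangles" and B: "B \<in> rectangles"
  shows "(\<lambda>n. measure M (A \<inter> ((T ^^ n) -` B \<inter> space M))) \<longlonglongrightarrow> measure M A * measure M B"
proof -
  obtain J X K Y where A: "A = {x. \<forall>i\<in>J. x i \<in> X i}" "finite J" "\<And>i. X i \<in> sets N"
    and B: "B = {x. \<forall>i\<in>K. x i \<in> Y i}" "finite K" "\<And>i. Y i \<in> sets N"
    using assms by (auto simp: rectangles_def)
  obtain n0 where n0: "\<And>i j. i \<in> J \<Longrightarrow> j \<in> K \<Longrightarrow> i - j < int n0"
  proof
    fix i j assume "i \<in> J" "j \<in> K"
    then have "i - j \<le> Max ((\<lambda>(i, j). i - j) ` (J \<times> K))"
      using A B by (intro Max_ge) auto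
    then show "i - j < int (nat (Max ((\<lambda>(i, j). i - j) ` (J \<times> K)) + 1))" by simp
  qed
  have "measure M (A \<inter> ((T ^^ n) -` B \<inter> space M)) = measure M A * measure M B" if "n0 \<le> n" for n
  proof -
    define K' where "K' = (\<lambda>k. k + int n) ` K"
    define Z where "Z i = (if i \<in> J then X i else Y (i - int n))" for i
    have nJ: "k + int n \<notin> J" if "k \<in> K" for k
      using n0[of "k + int n" k] that \<open>n0 \<le> n\<close> by auto
    then have disj: "J \<inter> K' = {}" by (auto simp: K'_def)
    have "A \<inter> ((T ^^ n) -` B \<inter> space M) = {x. \<forall>i\<in>J \<union> K'. x i \<in> Z i}"
      using nJ by (auto simp: A B Z_def K'_def funpow_T ball_Un)
    also have "measure M \<dots> = (\<Prod>i\<in>J \<union> K'. measure N (Z i))"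
      using A B by (intro measure_rectangle) (auto simp: K'_def Z_def)
    also have "\<dots> = (\<Prod>i\<in>J. measure N (Z i)) * (\<Prod>i\<in>K'. measure N (Z i))"
      using A B disj by (intro prod.union_disjoint) (auto simp: K'_def)
    also have "(\<Prod>i\<in>J. measure N (Z i)) = measure M A"
      using A by (simp add: measure_rectangle Z_def)
    also have "(\<Prod>i\<in>K'. measure N (Z i)) = (\<Prod>i\<in>K'. measure N (Y (i - int n)))"
      using disj by (intro prod.cong) (auto simp: Z_def)
    also have "\<dots> = measure M B"
      using B unfolding K'_def by (subst prod.reindex) (auto simp: measure_rectangle)
    finally show ?thesis .
  qed
  then show ?thesis
    by (intro tendsto_eventually eventually_sequentiallyI[of n0])
qed

text \<open>The limit passes from rectangles to all measurable sets in two rounds: first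
  \<open>A\<close> becomes arbitrary with \<open>B\<close> still a rectangle, then \<open>B\<close>
  becomes arbitrary with \<open>A\<close> fixed. Invariance of the measure supplies the domination
  in the second round.\<close>

lemma mixing:
  assumes A: "A \<in> sets M" and B: "B \<in> sets M"
  shows "(\<lambda>n. measure M (A \<inter> ((T ^^ n) -` B \<inter> space M))) \<longlonglongrightarrow> measure M A * measure M B"
proof -
  have [measurable]: "T ^^ n \<in> measurable M M" for n unfolding funpow_T_eq by measurable
  have pres: "measure M ((T ^^ n) -` B) = measure M B" if "B \<in> sets M" for n B
    using measure_distr[OF measurable_shift[of "int n"] that] by (simp add: distr_shift funpow_T_eq)
  have pre: "(T ^^ n) -` B \<in> sets M" if "B \<in> sets M" for n B
    using measurable_sets[of "T ^^ n" M M B] that by simp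
  have "rectangles \<subseteq> Pow (space M)" by simp
  note G = Int_stable_rectangles this sets_M
  have rect: "B \<in> sets M" if "B \<in> rectangles" for B using that by (simp add: sets_M)
  have step: "(\<lambda>n. measure M (A \<inter> ((T ^^ n) -` B \<inter> space M))) \<longlonglongrightarrow> measure M A * measure M B"
    if A: "A \<in> sets M" and B: "B \<in> rectangles" for A B
  proof (rule Dynkin_tendsto_product[OF prob_space_axioms G])
    show "0 \<le> measure M (A \<inter> ((T ^^ n) -` B \<inter> space M)) \<and>
        measure M (A \<inter> ((T ^^ n) -` B \<inter> space M)) \<le> measure M A" if "A \<in> sets M" for n A
      using that by (auto intro: finite_measure_mono)
    show "measure M ((space M - A) \<inter> ((T ^^ n) -` B \<inter> space M)) =
        measure M (space M \<inter> ((T ^^ n) -` B \<inter> space M)) - measure M (A \<inter> ((T ^^ n) -` B \<inter> space M))"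
      if A: "A \<in> sets M" for n A
    proof -
      have "(space M - A) \<inter> ((T ^^ n) -` B \<inter> space M) = (T ^^ n) -` B - A \<inter> (T ^^ n) -` B" by auto
      then show ?thesis
        using A pre[OF rect[OF B], of n] by (simp add: finite_measure_Diff)
    qed
    show "(\<lambda>i. measure M (A i \<inter> ((T ^^ n) -` B \<inter> space M))) sums
        measure M ((\<Union>i. A i) \<inter> ((T ^^ n) -` B \<inter> space M))"
      if A: "range A \<subseteq> sets M" "disjoint_family A" for n A
    proof -
      have "(\<lambda>i. measure M (A i \<inter> (T ^^ n) -` B)) sums measure M (\<Union>i. A i \<inter> (T ^^ n) -` B)"
        using A pre[OF rect[OF B], of n]
        by (intro finite_measure_UNION) (auto simp: disjoint_family_on_def range_subsetD)
      then show ?thesis by (simp add: Int_UN_distrib2)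
    qed
    show "(\<lambda>n. measure M (space M \<inter> ((T ^^ n) -` B \<inter> space M))) \<longlonglongrightarrow> measure M B"
      by (simp add: pres rect[OF B])
    show "(\<lambda>n. measure M (A \<inter> ((T ^^ n) -` B \<inter> space M))) \<longlonglongrightarrow> measure M A * measure M B"
      if "A \<in> rectangles" for A
      using that B by (rule mixing_rectangles)
  qed (rule A)
  have "(\<lambda>n. measure M (A \<inter> ((T ^^ n) -` B \<inter> space M))) \<longlonglongrightarrow> measure M B * measure M A"
  proof (rule Dynkin_tendsto_product[OF prob_space_axioms G])
    show "0 \<le> measure M (A \<inter> ((T ^^ n) -` B \<inter> space M)) \<and>
        measure M (A \<inter> ((T ^^ n) -` B \<inter> space M)) \<le> measure M B" if "B \<in> sets M" for n B
      using that A pre[of B n] pres[of B n] finite_measure_mono[of "A \<inter> (T ^^ n) -` B" "(T ^^ n) -` B"]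
      by auto
    show "measure M (A \<inter> ((T ^^ n) -` (space M - B) \<inter> space M)) =
        measure M (A \<inter> ((T ^^ n) -` space M \<inter> space M)) - measure M (A \<inter> ((T ^^ n) -` B \<inter> space M))"
      if B: "B \<in> sets M" for n B
    proof -
      have "A \<inter> ((T ^^ n) -` (space M - B) \<inter> space M) = A - A \<inter> (T ^^ n) -` B" by auto
      then show ?thesis
        using A B pre[of B n] by (simp add: finite_measure_Diff)
    qed
    show "(\<lambda>i. measure M (A \<inter> ((T ^^ n) -` B i \<inter> space M))) sums
        measure M (A \<inter> ((T ^^ n) -` (\<Union>i. B i) \<inter> space M))"
      if B: "range B \<subseteq> sets M" "disjoint_family B" for n B
    proof -
      have "(\<lambda>i. measure M (A \<inter> (T ^^ n) -` B i)) sums measure M (\<Union>i. A \<inter> (T ^^ n) -` B i)"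
        using A B pre[of _ n]
        by (intro finite_measure_UNION) (auto simp: disjoint_family_on_def range_subsetD)
      then show ?thesis by (simp add: vimage_UN)
    qed
    show "(\<lambda>n. measure M (A \<inter> ((T ^^ n) -` B \<inter> space M))) \<longlonglongrightarrow> measure M B * measure M A"
      if "B \<in> rectangles" for B
      using step[OF A that] by (simp add: mult.commute)
    show "(\<lambda>n. measure M (A \<inter> ((T ^^ n) -` space M \<inter> space M))) \<longlonglongrightarrow> measure M A"
      by simp
  qed (rule B)
  then show ?thesis by (simp add: mult.commute)
qed

sublocale D: ergodic_dynamical_system M T
  by (rule D.ergodicI_mixing) (rule mixing)

section \<open>The filtration, and conditional means of future coordinates\<close>

lemma space_past [simp]: "space (past i) = UNIV"
  by (simp add: past_def space_measure_of_conv)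

lemma sets_past: "sets (past i) = sigma_sets UNIV {(\<lambda>x. x j) -` A | j A. j \<le> i \<and> A \<in> sets N}"
  by (simp add: past_def)

lemma past_mono: "i \<le> j \<Longrightarrow> sets (past i) \<subseteq> sets (past j)"
  unfolding sets_past by (rule sigma_sets_mono', safe, intro exI conjI, rule refl) auto

lemma subalgebra_past: "subalgebra M (past i)"
proof -
  have "(\<lambda>x. x j) -` A \<in> sets M" if "A \<in> sets N" for j A
    using measurable_sets[OF measurable_coordinate that] by simp
  then have "{(\<lambda>x. x j) -` A | j A. j \<le> i \<and> A \<in> sets N} \<subseteq> sets M" by auto
  from sets.sigma_sets_subset[OF this] have "sets (past i) \<subseteq> sets M" by (simp add: sets_past)
  then show ?thesis by (simp add: subalgebra_def)
qed

text \<open>Generating a sigma-algebra commutes with taking preimages, so generators suffice: the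
  preimage under \<open>T\<close> of an event about coordinate \<open>j\<close> is the same event
  about coordinate \<open>j + 1\<close>.\<close>

lemma vimage_T_past: "(\<lambda>A. T -` A \<inter> space M) ` sets (past i) = sets (past (i + 1))"
proof -
  have "(\<lambda>A. T -` A \<inter> space M) ` sets (past i) = {T -` A \<inter> UNIV | A. A \<in> sets (past i)}"
    by auto
  also have "\<dots> = sigma_sets UNIV {T -` A \<inter> UNIV | A. A \<in> {(\<lambda>x. x j) -` A | j A. j \<le> i \<and> A \<in> sets N}}"
    unfolding sets_past by (rule sigma_sets_vimage_commute) simp
  also have "{T -` A \<inter> UNIV | A. A \<in> {(\<lambda>x. x j) -` A | j A. j \<le> i \<and> A \<in> sets N}}
      = {(\<lambda>x. x j) -` A | j A. j \<le> i + 1 \<and> A \<in> sets N}" (is "?L = ?R")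
  proof
    show "?L \<subseteq> ?R"
    proof safe
      fix j A assume "j \<le> i" "A \<in> sets N"
      then show "\<exists>j' A'. T -` (\<lambda>x. x j) -` A \<inter> UNIV = (\<lambda>x. x j') -` A' \<and> j' \<le> i + 1 \<and> A' \<in> sets N"
        by (intro exI[of _ "j + 1"] exI[of _ A]) (simp add: T_def vimage_def)
    qed
    show "?R \<subseteq> ?L"
    proof safe
      fix j A assume "j \<le> i + 1" "A \<in> sets N"
      then show "\<exists>B. (\<lambda>x. x j) -` A = T -` B \<inter> UNIV \<and>
          B \<in> {(\<lambda>x. x j) -` A | j A. j \<le> i \<and> A \<in> sets N}"
        by (intro exI[of _ "(\<lambda>x. x (j - 1)) -` A"] conjI CollectI exI[of _ "j - 1"] exI[of _ A])
          (simp_all add: T_def vimage_def)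
    qed
  qed
  finally show ?thesis by (simp add: sets_past)
qed

lemma measurable_coordinate_past: "j \<le> i \<Longrightarrow> (\<lambda>x. x j) \<in> measurable (past i) N"
  by (rule measurableI) (auto simp: sets_past intro!: sigma_sets.Basic)

text \<open>The joint law of all coordinates is \<open>M\<close> itself, which is by construction
  the product of the marginals.\<close>

lemma indep_coordinates: "indep_vars (\<lambda>_. N) (\<lambda>i x. x i) UNIV"
proof (subst indep_vars_iff_distr_eq_PiM)
  have "distr M (PiM UNIV (\<lambda>_. N)) (\<lambda>x. x) = M"
    by (rule distr_id2) (simp only: M_def)
  then show "distr M (PiM UNIV (\<lambda>_. N)) (\<lambda>x. \<lambda>i\<in>UNIV. x i) = PiM UNIV (\<lambda>i. distr M N (\<lambda>x. x i))"
    unfolding distr_coordinate restrict_UNIV M_def[symmetric] .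
  show "(\<lambda>x. x i) \<in> measurable M N" for i by (rule measurable_coordinate)
qed (rule UNIV_not_empty)

text \<open>Coordinate \<open>j\<close> is independent of the coordinates up to \<open>i\<close>.
  Hence the integral of \<open>g (x j)\<close> over an event of the past factors, and the factor
  coming from \<open>g\<close> is zero.\<close>

lemma real_cond_exp_future:
  assumes g: "g \<in> borel_measurable N" "integrable N g" "(\<integral>y. g y \<partial>N) = 0" and ij: "i < j"
  shows "AE x in M. real_cond_exp M (past i) (\<lambda>x. g (x j)) x = 0"
proof -
  interpret finite_measure_subalgebra M "past i" by unfold_locales (rule subalgebra_past)
  have gi: "integrable M (\<lambda>x. g (x j))"
    using integrable_distr[OF measurable_coordinate, of j g] g(2) unfolding distr_coordinate .
  have g0: "(\<integral>x. g (x j) \<partial>M) = 0"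
    using integral_distr[OF measurable_coordinate g(1), of j] g(3) by (simp only: distr_coordinate)
  let ?P = "PiM {..i} (\<lambda>_. N)"
  have ind: "indep_var ?P (\<lambda>x. restrict (\<lambda>k. x k) {..i}) (PiM {j} (\<lambda>_. N)) (\<lambda>x. restrict (\<lambda>k. x k) {j})"
    using ij by (intro indep_var_restrict[OF indep_coordinates]) auto
  \<comment> \<open>Preimages of measurable sets under the restriction to \<open>{..i}\<close> form
    a sigma-algebra that contains the generators of \<open>past i\<close>. So every past event is
    such a preimage, and its indicator is a function of the restricted variable, to which
    independence applies.\<close>
  let ?R = "\<lambda>x. restrict x {..i}"
  have R: "?R \<in> UNIV \<rightarrow> space ?P" by (simp add: space_PiM)
  have "{(\<lambda>x. x k) -` A | k A. k \<le> i \<and> A \<in> sets N} \<subseteq> sets (vimage_algebra UNIV ?R ?P)"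
  proof safe
    fix k A assume k: "k \<le> i" "A \<in> sets N"
    have "(\<lambda>x. x k) -` A \<inter> space ?P \<in> sets ?P"
      using k by (intro measurable_sets[OF measurable_component_singleton]) auto
    then have "?R -` ((\<lambda>x. x k) -` A \<inter> space ?P) \<inter> UNIV \<in> sets (vimage_algebra UNIV ?R ?P)"
      by (rule in_vimage_algebra)
    also have "?R -` ((\<lambda>x. x k) -` A \<inter> space ?P) \<inter> UNIV = (\<lambda>x. x k) -` A"
      using k by (auto simp: space_PiM)
    finally show "(\<lambda>x. x k) -` A \<in> sets (vimage_algebra UNIV ?R ?P)" .
  qed
  from sets.sigma_sets_subset[OF this]
  have past_subset: "sets (past i) \<subseteq> {?R -` B \<inter> UNIV | B. B \<in> sets ?P}"
    by (simp add: sets_past sets_vimage_algebra2[OF R])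
  show ?thesis
  proof (rule real_cond_exp_charact[OF _ gi])
    fix A assume A: "A \<in> sets (past i)"
    then obtain B where B[measurable]: "B \<in> sets ?P" and AB: "A = (\<lambda>x. restrict x {..i}) -` B"
      using past_subset by auto
    have "indep_var borel ((\<lambda>y. indicator B y :: real) \<circ> (\<lambda>x. restrict (\<lambda>k. x k) {..i}))
        borel ((\<lambda>y. g (y j)) \<circ> (\<lambda>x. restrict (\<lambda>k. x k) {j}))"
    proof (rule indep_var_compose[OF ind])
      show "(\<lambda>y. indicator B y :: real) \<in> borel_measurable ?P" by measurable
      show "(\<lambda>y. g (y j)) \<in> borel_measurable (PiM {j} (\<lambda>_. N))"
        by (rule measurable_compose[OF _ g(1)]) (rule measurable_component_singleton, simp)
    qed
    moreover have "(\<lambda>y. indicator B y :: real) \<circ> (\<lambda>x. restrict (\<lambda>k. x k) {..i}) = indicator A"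
      by (auto simp: AB fun_eq_iff indicator_def)
    ultimately have "indep_var borel (indicator A) borel (\<lambda>x. g (x j))"
      by (simp add: comp_def)
    moreover have "A \<in> sets M" using A subalgebra_past by (auto simp: subalgebra_def)
    ultimately have "(\<integral>x. indicator A x * g (x j) \<partial>M) = 0"
      using indep_var_lebesgue_integral[of "indicator A" "\<lambda>x. g (x j)"] gi g0
      by (simp add: emeasure_eq_measure)
    then show "(\<integral>x\<in>A. g (x j) \<partial>M) = (\<integral>x\<in>A. 0 \<partial>M)"
      by (simp add: set_lebesgue_integral_def)
  qed auto
qed

end

section \<open>Moving averages\<close>

definition standardized :: "'a measure \<Rightarrow> ('a \<Rightarrow> real) \<Rightarrow> bool" where
  "standardized N \<phi> \<longleftrightarrow>
    square_integrable N \<phi> \<and> (\<integral>y. \<phi> y \<partial>N) = 0 \<and> (\<integral>y. (\<phi> y)\<^sup>2 \<partial>N) = 1"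

context bernoulli_shift
begin

definition moving_average :: "real \<Rightarrow> nat \<Rightarrow> ('b \<Rightarrow> real) \<Rightarrow> (int \<Rightarrow> 'b) \<Rightarrow> real" where
  "moving_average s m \<phi> x = s / real m * (\<Sum>j<m. \<phi> (x (- int j)))"

lemma square_integrable_coordinate:
  "square_integrable N \<phi> \<Longrightarrow> square_integrable M (\<lambda>x. \<phi> (x i))"
  by (rule square_integrable_compose[OF measurable_coordinate distr_coordinate])

lemma L2_norm_coordinate:
  assumes "standardized N \<phi>"
  shows "L2_norm M (\<lambda>x. \<phi> (x i)) = 1"
proof -
  have "L2_norm M (\<lambda>x. \<phi> (x i)) = L2_norm N \<phi>"
    using assms
    by (intro L2_norm_compose[OF measurable_coordinate distr_coordinate])
      (auto simp: standardized_def square_integrable_def)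
  then show ?thesis using assms by (simp add: L2_norm_def standardized_def)
qed

lemma integral_coordinate:
  fixes g :: "'b \<Rightarrow> 'c :: {banach, second_countable_topology}"
  assumes "g \<in> borel_measurable N"
  shows "(\<integral>x. g (x i) \<partial>M) = (\<integral>y. g y \<partial>N)"
  using integral_distr[OF measurable_coordinate assms, of i] by (simp only: distr_coordinate)

lemma indep_coordinates_compose:
  assumes "\<And>i. g i \<in> borel_measurable N"
  shows "indep_vars (\<lambda>_. borel) (\<lambda>i x. g i (x i)) I"
  by (rule indep_vars_compose2[OF indep_vars_subset[OF indep_coordinates subset_UNIV]]) (rule assms)

lemma orthogonal_coordinates:
  assumes \<phi>: "standardized N \<phi>" and ij: "i \<noteq> j"
  shows "(\<integral>x. \<phi> (x i) * \<phi> (x j) \<partial>M) = 0"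
proof -
  have \<phi>': "\<phi> \<in> borel_measurable N" "square_integrable N \<phi>" "(\<integral>y. \<phi> y \<partial>N) = 0"
    using \<phi> by (auto simp: standardized_def square_integrable_def)
  have "(\<integral>x. (\<Prod>k\<in>{i, j}. \<phi> (x k)) \<partial>M) = (\<Prod>k\<in>{i, j}. \<integral>x. \<phi> (x k) \<partial>M)"
    using \<phi>' by (intro indep_vars_lebesgue_integral indep_coordinates_compose
        square_integrable_integrable square_integrable_coordinate) auto
  also have "\<dots> = 0"
    using integral_coordinate[OF \<phi>'(1), of i] \<phi>'(3) by (simp only:) (simp add: ij)
  finally show ?thesis using ij by simp
qed

lemma L2_norm_sum_coordinates:
  assumes \<phi>: "standardized N \<phi>" and I: "finite I"
  shows "L2_norm M (\<lambda>x. \<Sum>i\<in>I. \<phi> (x i)) = sqrt (card I)"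
proof -
  have si: "square_integrable M (\<lambda>x. \<phi> (x i))" for i
    using \<phi> by (intro square_integrable_coordinate) (simp add: standardized_def)
  have "(\<integral>x. (\<Sum>i\<in>I. \<phi> (x i))\<^sup>2 \<partial>M) = (\<integral>x. (\<Sum>i\<in>I. \<Sum>j\<in>I. \<phi> (x i) * \<phi> (x j)) \<partial>M)"
    by (simp add: power2_eq_square sum_product)
  also have "\<dots> = (\<Sum>i\<in>I. \<Sum>j\<in>I. \<integral>x. \<phi> (x i) * \<phi> (x j) \<partial>M)"
    using square_integrable_mult[OF si si] by simp
  also have "\<dots> = (\<Sum>i\<in>I. \<Sum>j\<in>I. if i = j then 1 else 0)"
  proof (intro sum.cong refl)
    fix i j
    have "(L2_norm M (\<lambda>x. \<phi> (x i)))\<^sup>2 = 1" by (simp add: L2_norm_coordinate \<phi>)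
    then have "(\<integral>x. (\<phi> (x i))\<^sup>2 \<partial>M) = 1" by (simp add: L2_norm_sq)
    then show "(\<integral>x. \<phi> (x i) * \<phi> (x j) \<partial>M) = (if i = j then 1 else 0)"
      using orthogonal_coordinates[OF \<phi>, of i j] by (cases "i = j") (simp_all add: power2_eq_square)
  qed
  also have "\<dots> = card I" using I by simp
  finally show ?thesis by (simp add: L2_norm_def)
qed

lemma L2_norm_sum_coordinates_inj:
  assumes \<phi>: "standardized N \<phi>" and I: "finite I" "inj_on h I"
  shows "L2_norm M (\<lambda>x. \<Sum>i\<in>I. \<phi> (x (h i))) = sqrt (card I)"
  using L2_norm_sum_coordinates[OF \<phi>, of "h ` I"] I by (simp add: sum.reindex card_image)

lemma square_integrable_sum_coordinates:
  "standardized N \<phi> \<Longrightarrow> square_integrable M (\<lambda>x. \<Sum>i\<in>I. \<phi> (x (h i)))"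
  by (intro square_integrable_sum square_integrable_coordinate) (simp add: standardized_def)

lemma square_integrable_funpow_T:
  "square_integrable M g \<Longrightarrow> square_integrable M (\<lambda>x. g ((T ^^ i) x))"
  unfolding funpow_T_eq by (rule square_integrable_compose[OF measurable_shift distr_shift])

lemma L2_norm_funpow_T:
  "square_integrable M g \<Longrightarrow> L2_norm M (\<lambda>x. g ((T ^^ i) x)) = L2_norm M g"
  unfolding funpow_T_eq
  by (rule L2_norm_compose[OF measurable_shift distr_shift]) (rule square_integrable_measurable)

lemma square_integrable_birkhoff_sum:
  "square_integrable M g \<Longrightarrow> square_integrable M (birkhoff_sum T g n)"
  unfolding birkhoff_sum_def by (intro square_integrable_sum square_integrable_funpow_T)

text \<open>Triangle inequality and stationarity. The bound ignores cancellation, but it is enough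
  for the remainder of the series and for times shorter than the averaging length.\<close>

lemma L2_norm_birkhoff_sum_le:
  assumes "square_integrable M g"
  shows "L2_norm M (birkhoff_sum T g n) \<le> real n * L2_norm M g"
proof -
  have "L2_norm M (birkhoff_sum T g n) \<le> (\<Sum>i<n. L2_norm M (\<lambda>x. g ((T ^^ i) x)))"
    unfolding birkhoff_sum_def using assms by (intro L2_norm_sum_le square_integrable_funpow_T)
  then show ?thesis using assms by (simp add: L2_norm_funpow_T)
qed

lemma moving_average_funpow_T:
  "moving_average s m \<phi> ((T ^^ i) x) = s / real m * (\<Sum>j<m. \<phi> (x (int i - int j)))"
  by (simp add: moving_average_def funpow_T add.commute)

lemma birkhoff_sum_moving_average:
  "birkhoff_sum T (moving_average s m \<phi>) n x
    = s / real m * (\<Sum>j<m. \<Sum>i<n. \<phi> (x (int i - int j)))"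
  unfolding birkhoff_sum_def moving_average_funpow_T
  by (subst sum.swap) (simp add: sum_distrib_left)

lemma square_integrable_moving_average:
  "standardized N \<phi> \<Longrightarrow> square_integrable M (moving_average s m \<phi>)"
  unfolding moving_average_def by (intro square_integrable_cmult square_integrable_sum_coordinates)

lemma L2_norm_moving_average:
  assumes "standardized N \<phi>" "0 \<le> s"
  shows "L2_norm M (moving_average s m \<phi>) = s / sqrt (real m)"
proof -
  have "L2_norm M (moving_average s m \<phi>) = s / real m * sqrt (real m)"
    unfolding moving_average_def L2_norm_cmult
    using assms L2_norm_sum_coordinates_inj[OF assms(1), of "{..<m}" "\<lambda>j. - int j"]
    by (simp add: inj_on_def)
  also have "\<dots> = s / sqrt (real m)"
    by (cases "m = 0") (simp_all add: field_simps)
  finally show ?thesis .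
qed

lemma moving_average_past: 
  assumes "\<phi> \<in> borel_measurable N"
  shows "moving_average s m \<phi> \<in> borel_measurable (past 0)"
  unfolding moving_average_def
  by (intro borel_measurable_times borel_measurable_const borel_measurable_sum
      measurable_compose[OF measurable_coordinate_past assms]) simp

lemma integral_moving_average:
  assumes "standardized N \<phi>"
  shows "(\<integral>x. moving_average s m \<phi> x \<partial>M) = 0"
proof -
  have \<phi>: "square_integrable N \<phi>" "(\<integral>y. \<phi> y \<partial>N) = 0" "\<phi> \<in> borel_measurable N"
    using assms by (auto simp: standardized_def square_integrable_def)
  have "integrable M (\<lambda>x. \<phi> (x i))" for i
    by (intro square_integrable_integrable square_integrable_coordinate \<phi>)
  moreover have "(\<integral>x. \<phi> (x i) \<partial>M) = 0" for i
    using integral_coordinate[OF \<phi>(3), of i] \<phi>(2) by (rule trans)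
  ultimately show ?thesis unfolding moving_average_def by simp
qed

text \<open>The Birkhoff sum is \<open>s\<close> times the average, over \<open>j < m\<close>, of
  the sum over a window of \<open>n\<close> coordinates shifted back by \<open>j\<close>. Undoing
  such a shift costs at most \<open>2 * j\<close> in norm, whatever \<open>n\<close> is. So the
  error is a boundary term, negligible against \<open>s * sqrt n\<close> once \<open>n\<close> is
  large compared with the square of \<open>m\<close>.\<close>

lemma L2_norm_birkhoff_sum_moving_average_diff:
  assumes \<phi>: "standardized N \<phi>" and s: "0 \<le> s" and m: "0 < m"
  shows "L2_norm M (\<lambda>x. birkhoff_sum T (moving_average s m \<phi>) n x - s * (\<Sum>i<n. \<phi> (x (int i))))
    \<le> 2 * real m * s"
proof -
  define D where "D j x = (\<Sum>i<n. \<phi> (x (int i - int j))) - (\<Sum>i<n. \<phi> (x (int i)))" for j x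
  have si: "square_integrable M (\<lambda>x. \<phi> (x i))" for i
    using \<phi> by (intro square_integrable_coordinate) (simp add: standardized_def)
  have Dsi: "square_integrable M (D j)" for j
    unfolding D_def by (intro square_integrable_diff square_integrable_sum si)
  have D: "L2_norm M (D j) \<le> 2 * real j" for j
  proof (induction j)
    case 0
    then show ?case by (simp add: D_def)
  next
    case (Suc j)
    \<comment> \<open>Moving the window by one position gains one coordinate at its left end and
      loses one at its right end, each of norm 1.\<close>
    have tel: "(\<Sum>i<n. \<phi> (x (int i - int (Suc j)))) - (\<Sum>i<n. \<phi> (x (int i - int j)))
        = \<phi> (x (- int (Suc j))) - \<phi> (x (int n - int (Suc j)))" for x
    proof (induction n)
      case (Suc n)
      have "int (Suc n) - int (Suc j) = int n - int j" by simp
      with Suc show ?case unfolding sum.lessThan_Suc by simp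
    qed simp
    have "D (Suc j) = (\<lambda>x. D j x + (\<phi> (x (- int (Suc j))) - \<phi> (x (int n - int (Suc j)))))"
      unfolding tel[symmetric] by (simp add: D_def fun_eq_iff)
    then have "L2_norm M (D (Suc j)) = L2_norm M (\<lambda>x. D j x + (\<phi> (x (- int (Suc j))) - \<phi> (x (int n - int (Suc j)))))"
      by (rule arg_cong)
    also have "\<dots> \<le> L2_norm M (D j)
        + L2_norm M (\<lambda>x. \<phi> (x (- int (Suc j))) - \<phi> (x (int n - int (Suc j))))"
      by (intro L2_norm_add_le Dsi square_integrable_diff si)
    also have "\<dots> \<le> 2 * real j + (1 + 1)"
      using L2_norm_diff_le[OF si[of "- int (Suc j)"] si[of "int n - int (Suc j)"]] Suc
      unfolding L2_norm_coordinate[OF \<phi>] by linarith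
    finally show ?case by simp
  qed
  have "birkhoff_sum T (moving_average s m \<phi>) n x - s * (\<Sum>i<n. \<phi> (x (int i)))
      = s / real m * (\<Sum>j<m. D j x)" for x
    using m by (simp add: birkhoff_sum_moving_average D_def sum_subtractf right_diff_distrib)
  then have "L2_norm M (\<lambda>x. birkhoff_sum T (moving_average s m \<phi>) n x - s * (\<Sum>i<n. \<phi> (x (int i))))
      = s / real m * L2_norm M (\<lambda>x. \<Sum>j<m. D j x)"
    using s by (simp only: L2_norm_cmult) simp
  also have "\<dots> \<le> s / real m * (\<Sum>j<m. 2 * real m)"
  proof (intro mult_left_mono)
    have "L2_norm M (\<lambda>x. \<Sum>j<m. D j x) \<le> (\<Sum>j<m. L2_norm M (D j))"
      by (intro L2_norm_sum_le Dsi)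
    also have "\<dots> \<le> (\<Sum>j<m. 2 * real m)"
      by (intro sum_mono order_trans[OF D]) simp
    finally show "L2_norm M (\<lambda>x. \<Sum>j<m. D j x) \<le> (\<Sum>j<m. 2 * real m)" .
  qed (use s in simp)
  also have "\<dots> = 2 * real m * s" using m by simp
  finally show ?thesis .
qed

lemma L2_norm_birkhoff_sum_moving_average_le:
  assumes \<phi>: "standardized N \<phi>" and s: "0 \<le> s" and m: "0 < m"
  shows "L2_norm M (birkhoff_sum T (moving_average s m \<phi>) n) \<le> s * sqrt (real n) + 2 * real m * s"
proof -
  have "\<bar>L2_norm M (birkhoff_sum T (moving_average s m \<phi>) n) - L2_norm M (\<lambda>x. s * (\<Sum>i<n. \<phi> (x (int i))))\<bar>
      \<le> 2 * real m * s"
    by (rule order_trans[OF abs_L2_norm_diff_le L2_norm_birkhoff_sum_moving_average_diff[OF assms]])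
      (intro square_integrable_birkhoff_sum square_integrable_moving_average square_integrable_cmult
        square_integrable_sum_coordinates \<phi>)+
  moreover have "L2_norm M (\<lambda>x. s * (\<Sum>i<n. \<phi> (x (int i)))) = s * sqrt (real n)"
    using s by (simp add: L2_norm_cmult L2_norm_sum_coordinates_inj \<phi> inj_on_def)
  ultimately show ?thesis by linarith
qed

text \<open>Innovations with positive index are averaged out, so only the terms with \<^term>\<open>i \<le> j\<close> of the
  double sum over \<^term>\<open>i < n\<close> and \<^term>\<open>j < m\<close> survive, at most \<^term>\<open>m\<close> of them for each \<^term>\<open>j\<close>.\<close>

lemma L2_norm_cond_exp_birkhoff_sum_moving_average:
  assumes \<phi>: "standardized N \<phi>" and s: "0 \<le> s" and m: "0 < m"
  shows "L2_norm M (real_cond_exp M (past 0) (birkhoff_sum T (moving_average s m \<phi>) n))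
    \<le> s * real (min n m) / sqrt (real m)"
proof -
  interpret finite_measure_subalgebra M "past 0" by unfold_locales (rule subalgebra_past)
  let ?E = "real_cond_exp M (past 0)"
  have \<phi>': "\<phi> \<in> borel_measurable N" "square_integrable N \<phi>" "(\<integral>y. \<phi> y \<partial>N) = 0" "integrable N \<phi>"
    using \<phi> by (auto simp: standardized_def square_integrable_def intro: N.square_integrable_imp_integrable)
  have si: "square_integrable M (\<lambda>x. \<phi> (x i))" for i
    using \<phi>' by (intro square_integrable_coordinate)
  have int: "integrable M (\<lambda>x. \<phi> (x i))" for i
    by (rule square_integrable_integrable[OF si])
  have E1: "AE x in M. ?E (\<lambda>x. \<phi> (x i)) x = (if i \<le> 0 then \<phi> (x i) else 0)" for i
  proof (cases "i \<le> 0")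
    case True
    then show ?thesis
      using real_cond_exp_F_meas[OF int measurable_compose[OF measurable_coordinate_past \<phi>'(1)], of i] by simp
  next
    case False
    then show ?thesis using real_cond_exp_future[of \<phi> 0 i] \<phi>' by simp
  qed
  define V where "V j x = (\<Sum>i<n. if int i - int j \<le> 0 then \<phi> (x (int i - int j)) else 0)" for j x
  have Vsum: "V j x = (\<Sum>i\<in>{i\<in>{..<n}. i \<le> j}. \<phi> (x (int i - int j)))" for j x
    by (subst sum.inter_filter) (auto simp: V_def intro!: sum.cong)
  have Vsi: "square_integrable M (V j)" for j
    unfolding Vsum by (intro square_integrable_sum_coordinates \<phi>)
  have AE: "AE x in M. ?E (birkhoff_sum T (moving_average s m \<phi>) n) x = s / real m * (\<Sum>j<m. V j x)"
  proof -
    have "AE x in M. ?E (\<lambda>x. s / real m * (\<Sum>j<m. \<Sum>i<n. \<phi> (x (int i - int j)))) x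
        = s / real m * ?E (\<lambda>x. \<Sum>j<m. \<Sum>i<n. \<phi> (x (int i - int j))) x"
      using int by (intro real_cond_exp_cmult) auto
    moreover have "AE x in M. ?E (\<lambda>x. \<Sum>j<m. \<Sum>i<n. \<phi> (x (int i - int j))) x
        = (\<Sum>j<m. ?E (\<lambda>x. \<Sum>i<n. \<phi> (x (int i - int j))) x)"
      using int by (intro real_cond_exp_sum) auto
    moreover have "AE x in M. \<forall>j\<in>{..<m}. ?E (\<lambda>x. \<Sum>i<n. \<phi> (x (int i - int j))) x
        = (\<Sum>i<n. ?E (\<lambda>x. \<phi> (x (int i - int j))) x)"
      using int by (intro AE_finite_allI real_cond_exp_sum) auto
    moreover have "AE x in M. \<forall>j\<in>{..<m}. \<forall>i\<in>{..<n}. ?E (\<lambda>x. \<phi> (x (int i - int j))) x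
        = (if int i - int j \<le> 0 then \<phi> (x (int i - int j)) else 0)"
      by (intro AE_finite_allI E1) auto
    ultimately show ?thesis
    proof eventually_elim
      case (elim x)
      then show ?case unfolding birkhoff_sum_moving_average V_def by simp
    qed
  qed
  have sq: "s / real m * (real m * sqrt (real m)) = s * real m / sqrt (real m)"
    "s / real m * (real n * sqrt (real m)) = s * real n / sqrt (real m)"
    using m by (simp_all add: field_simps)
  have "L2_norm M (?E (birkhoff_sum T (moving_average s m \<phi>) n)) = L2_norm M (\<lambda>x. s / real m * (\<Sum>j<m. V j x))"
    using AE square_integrable_measurable[OF Vsi] by (intro L2_norm_cong_AE) auto
  also have "\<dots> = s / real m * L2_norm M (\<lambda>x. \<Sum>j<m. V j x)"
    using s by (simp only: L2_norm_cmult) simp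
  also have "\<dots> \<le> s / real m * (\<Sum>j<m. sqrt (real m))"
  proof (intro mult_left_mono)
    have "L2_norm M (\<lambda>x. \<Sum>j<m. V j x) \<le> (\<Sum>j<m. L2_norm M (V j))"
      by (intro L2_norm_sum_le Vsi)
    also have "\<dots> \<le> (\<Sum>j<m. sqrt (real m))"
    proof (intro sum_mono)
      fix j assume "j \<in> {..<m}"
      then have "card {i \<in> {..<n}. i \<le> j} \<le> card {..<m}" by (intro card_mono) auto
      then show "L2_norm M (V j) \<le> sqrt (real m)"
        unfolding Vsum by (subst L2_norm_sum_coordinates_inj[OF \<phi>]) (auto simp: inj_on_def)
    qed
    finally show "L2_norm M (\<lambda>x. \<Sum>j<m. V j x) \<le> (\<Sum>j<m. sqrt (real m))" .
  qed (use s in simp)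
  also have "\<dots> = s * real m / sqrt (real m)" using sq by simp
  finally have 1: "L2_norm M (?E (birkhoff_sum T (moving_average s m \<phi>) n)) \<le> s * real m / sqrt (real m)" .
  \<comment> \<open>For \<open>n\<close> below \<open>m\<close> nothing is gained from conditioning:
    contractivity and the triangle inequality replace the factor \<open>m\<close> by
    \<open>n\<close>.\<close>
  have "L2_norm M (?E (birkhoff_sum T (moving_average s m \<phi>) n))
      \<le> L2_norm M (birkhoff_sum T (moving_average s m \<phi>) n)"
    by (intro L2_norm_real_cond_exp_le subalgebra_past square_integrable_birkhoff_sum
        square_integrable_moving_average \<phi>)
  also have "\<dots> \<le> real n * L2_norm M (moving_average s m \<phi>)"
    by (intro L2_norm_birkhoff_sum_le square_integrable_moving_average \<phi>)
  also have "\<dots> = s * real n / sqrt (real m)"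
    using \<phi> s by (simp add: L2_norm_moving_average)
  finally have 2: "L2_norm M (?E (birkhoff_sum T (moving_average s m \<phi>) n)) \<le> s * real n / sqrt (real m)" .
  show ?thesis using 1 2 by (simp add: min_def)
qed

end

section \<open>Superpositions of moving averages\<close>

text \<open>Here \<open>e\<close> is the relative error of approximating \<open>X\<close> by
  \<open>Y\<close>. The difference of the normalized functions splits into
  \<open>(1 / L2_norm M X - 1 / a) * X\<close> and \<open>(X - Y) / a\<close>, each of norm at most
  \<open>e\<close>: the first by the reverse triangle inequality. The condition \<open>e < 1\<close>
  keeps the norm of \<open>X\<close> away from 0.\<close>

lemma L2_norm_normalize:
  assumes X: "square_integrable M X" and Y: "square_integrable M Y"
    and a: "L2_norm M Y = a" "0 < a" and le: "L2_norm M (\<lambda>x. X x - Y x) \<le> e * a" and e: "e < 1"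
  shows "0 < L2_norm M X" and "L2_norm M (\<lambda>x. X x / L2_norm M X - Y x / a) \<le> 2 * e"
proof -
  let ?n = "L2_norm M X"
  have d: "\<bar>?n - a\<bar> \<le> e * a"
    using abs_L2_norm_diff_le[OF X Y] le a by simp
  have "e * a < 1 * a" using a(2) e by (intro mult_strict_right_mono)
  with d show n: "0 < ?n" by linarith
  have "L2_norm M (\<lambda>x. X x / ?n - Y x / a)
      = L2_norm M (\<lambda>x. (1 / ?n - 1 / a) * X x + (X x - Y x) / a)"
    by (intro arg_cong[where f = "L2_norm M"] ext) (simp add: field_simps diff_divide_distrib)
  also have "\<dots> \<le> L2_norm M (\<lambda>x. (1 / ?n - 1 / a) * X x) + L2_norm M (\<lambda>x. (X x - Y x) / a)"
    by (intro L2_norm_add_le square_integrable_cmult square_integrable_divide square_integrable_diff X Y)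
  also have "L2_norm M (\<lambda>x. (1 / ?n - 1 / a) * X x) = \<bar>1 / ?n - 1 / a\<bar> * ?n"
    by (rule L2_norm_cmult)
  also have "1 / ?n - 1 / a = (a - ?n) / (?n * a)"
    using n a(2) by (simp add: field_simps)
  also have "\<bar>(a - ?n) / (?n * a)\<bar> * ?n = \<bar>?n - a\<bar> / a"
    using n a(2) by (simp add: abs_mult abs_minus_commute)
  also have "L2_norm M (\<lambda>x. (X x - Y x) / a) = L2_norm M (\<lambda>x. X x - Y x) / a"
    using a(2) by (simp add: L2_norm_divide)
  also have "\<bar>?n - a\<bar> / a + L2_norm M (\<lambda>x. X x - Y x) / a \<le> e + e"
    using d le a(2) by (intro add_mono) (simp_all add: pos_divide_le_eq)
  finally show "L2_norm M (\<lambda>x. X x / ?n - Y x / a) \<le> 2 * e" by simp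
qed

locale superposition = bernoulli_shift N for N :: "'b measure" +
  fixes \<phi> :: "nat \<Rightarrow> 'b \<Rightarrow> real" and s :: "nat \<Rightarrow> real" and m :: "nat \<Rightarrow> nat"
  assumes std: "\<And>k. standardized N (\<phi> k)"
    and s_pos: "\<And>k. 0 < s k" and m_pos: "\<And>k. 0 < m k"
    and summable_norms: "summable (\<lambda>k. s k / sqrt (real (m k)))"
begin

abbreviation component :: "nat \<Rightarrow> (int \<Rightarrow> 'b) \<Rightarrow> real" where
  "component k \<equiv> moving_average (s k) (m k) (\<phi> k)"

text \<open>A pointwise sum rather than a limit in L2, so that \<open>f\<close> is
  \<open>past 0\<close>-measurable as a function and not only up to a null set.\<close>

definition f :: "(int \<Rightarrow> 'b) \<Rightarrow> real" where
  "f x = (\<Sum>k. component k x)"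

definition tail :: "nat \<Rightarrow> real" where
  "tail K = (\<Sum>k. s (k + K) / sqrt (real (m (k + K))))"

lemma s_nonneg: "0 \<le> s k"
  using s_pos[of k] by simp

lemma \<phi>_measurable: "\<phi> k \<in> borel_measurable N"
  using std[of k] by (simp add: standardized_def square_integrable_def)

lemma L2_norm_component: "L2_norm M (component k) = s k / sqrt (real (m k))"
  by (rule L2_norm_moving_average[OF std s_nonneg])

lemma square_integrable_component: "square_integrable M (component k)"
  by (rule square_integrable_moving_average[OF std])

lemma square_integrable_f: "square_integrable M f"
  unfolding f_def
  by (rule square_integrable_suminf) (simp_all add: square_integrable_component L2_norm_component summable_norms)

lemma f_past: "f \<in> borel_measurable (past 0)"
  unfolding f_def by (intro borel_measurable_suminf moving_average_past \<phi>_measurable)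

lemma tail_tendsto: "tail \<longlonglongrightarrow> 0"
proof -
  have "tail = (\<lambda>K. (\<Sum>k. s k / sqrt (real (m k))) - (\<Sum>k<K. s k / sqrt (real (m k))))"
    unfolding tail_def by (intro ext suminf_minus_initial_segment summable_norms)
  then show ?thesis
    using tendsto_diff[OF tendsto_const[of "\<Sum>k. s k / sqrt (real (m k))"] summable_LIMSEQ[OF summable_norms]]
    by simp
qed

lemma square_integrable_remainder: "square_integrable M (\<lambda>x. f x - (\<Sum>k<K. component k x))"
  by (intro square_integrable_diff square_integrable_f square_integrable_sum square_integrable_component)

text \<open>Subtracting a partial sum leaves the tail series only at points of convergence, so the
  identification is made almost everywhere before the norm bound for series applies.\<close>

lemma L2_norm_remainder: "L2_norm M (\<lambda>x. f x - (\<Sum>k<K. component k x)) \<le> tail K"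
proof -
  have sm: "summable (\<lambda>k. L2_norm M (component (k + K)))"
    unfolding L2_norm_component using summable_ignore_initial_segment[OF summable_norms, of K] .
  have "AE x in M. summable (\<lambda>k. component k x)"
    by (rule AE_summable_of_L2_norm) (simp_all add: square_integrable_component L2_norm_component summable_norms)
  then have "AE x in M. f x - (\<Sum>k<K. component k x) = (\<Sum>k. component (k + K) x)"
  proof eventually_elim
    case (elim x)
    show ?case unfolding f_def by (rule suminf_minus_initial_segment[OF elim, symmetric])
  qed
  then have "L2_norm M (\<lambda>x. f x - (\<Sum>k<K. component k x)) = L2_norm M (\<lambda>x. \<Sum>k. component (k + K) x)"
    by (intro L2_norm_cong_AE square_integrable_measurable square_integrable_remainder
        square_integrable_suminf square_integrable_component sm)
  also have "\<dots> \<le> (\<Sum>k. L2_norm M (component (k + K)))"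
    by (intro L2_norm_suminf_le square_integrable_component sm)
  finally show ?thesis by (simp add: L2_norm_component tail_def)
qed

text \<open>Partial sums have mean zero, so the mean of \<open>f\<close> is bounded by every
  \<open>tail K\<close>, and these tend to 0.\<close>

lemma integral_f: "(\<integral>x. f x \<partial>M) = 0"
proof -
  have "\<bar>\<integral>x. f x \<partial>M\<bar> \<le> tail K" for K
  proof -
    have int: "integrable M f" "\<And>k. integrable M (component k)"
      by (auto intro: square_integrable_integrable square_integrable_f square_integrable_component)
    have "(\<integral>x. f x \<partial>M) = (\<integral>x. f x - (\<Sum>k<K. component k x) \<partial>M)"
      using int by (simp add: integral_moving_average[OF std])
    also have "\<bar>\<dots>\<bar> \<le> (\<integral>x. \<bar>f x - (\<Sum>k<K. component k x)\<bar> \<partial>M)"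
      by (rule integral_abs_bound)
    also have "\<dots> \<le> tail K"
      using integral_abs_le_L2_norm[OF square_integrable_remainder] L2_norm_remainder by (rule order_trans)
    finally show ?thesis .
  qed
  then have "\<bar>\<integral>x. f x \<partial>M\<bar> \<le> 0"
    by (intro LIMSEQ_le_const[OF tail_tendsto]) auto
  then show ?thesis by simp
qed

section \<open>Birkhoff sums of the superposition\<close>

lemma birkhoff_sum_f:
  "birkhoff_sum T f n x
    = (\<Sum>k<K. birkhoff_sum T (component k) n x)
      + birkhoff_sum T (\<lambda>x. f x - (\<Sum>k<K. component k x)) n x"
proof -
  have "(\<Sum>k<K. birkhoff_sum T (component k) n x) = (\<Sum>i<n. \<Sum>k<K. component k ((T ^^ i) x))"
    unfolding birkhoff_sum_def by (rule sum.swap)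
  then show ?thesis unfolding birkhoff_sum_def by (simp add: sum_subtractf)
qed

lemma L2_norm_birkhoff_sum_remainder:
  "L2_norm M (birkhoff_sum T (\<lambda>x. f x - (\<Sum>k<K. component k x)) n) \<le> real n * tail K"
  by (rule order_trans[OF L2_norm_birkhoff_sum_le[OF square_integrable_remainder]])
    (simp add: mult_left_mono L2_norm_remainder)

text \<open>The first \<open>K\<close> components are estimated one by one, and the remainder
  contributes at most \<open>n * tail K\<close> since conditioning contracts the norm. With
  \<open>n\<close> fixed, letting \<open>K\<close> tend to infinity removes that
  contribution.\<close>

lemma
  fixes n :: nat
  shows summable_cond_exp_bound: "summable (\<lambda>k. s k * real (min n (m k)) / sqrt (real (m k)))"
    and L2_norm_cond_exp_birkhoff_sum_f:
      "L2_norm M (real_cond_exp M (past 0) (birkhoff_sum T f n))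
        \<le> (\<Sum>k. s k * real (min n (m k)) / sqrt (real (m k)))"
proof -
  interpret finite_measure_subalgebra M "past 0" by unfold_locales (rule subalgebra_past)
  let ?E = "real_cond_exp M (past 0)"
  let ?B = "\<lambda>k. s k * real (min n (m k)) / sqrt (real (m k))"
  show sm: "summable ?B"
  proof (rule summable_comparison_test'[OF summable_mult[OF summable_norms, of "real n"]])
    fix k
    have "s k * real (min n (m k)) \<le> s k * real n"
      by (intro mult_left_mono s_nonneg) simp
    then show "norm (?B k) \<le> real n * (s k / sqrt (real (m k)))"
      using s_nonneg[of k] by (simp add: abs_mult divide_right_mono mult.commute)
  qed
  have B_nonneg: "0 \<le> ?B k" for k using s_nonneg[of k] by simp
  have "L2_norm M (?E (birkhoff_sum T f n)) \<le> suminf ?B + real n * tail K" for K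
  proof -
    let ?r = "birkhoff_sum T (\<lambda>x. f x - (\<Sum>k<K. component k x)) n"
    let ?c = "\<lambda>k. birkhoff_sum T (component k) n"
    have si: "square_integrable M (?c k)" "square_integrable M ?r" for k
      by (auto intro!: square_integrable_birkhoff_sum square_integrable_component square_integrable_remainder)
    note int = si[THEN square_integrable_integrable]
    note siE = si[THEN square_integrable_real_cond_exp[OF subalgebra_past[of 0]]]
    have "AE x in M. ?E (\<lambda>x. (\<Sum>k<K. ?c k x) + ?r x) x = ?E (\<lambda>x. \<Sum>k<K. ?c k x) x + ?E ?r x"
      using int by (intro real_cond_exp_add) auto
    moreover have "AE x in M. ?E (\<lambda>x. \<Sum>k<K. ?c k x) x = (\<Sum>k<K. ?E (?c k) x)"
      using int by (intro real_cond_exp_sum)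
    ultimately have "AE x in M. ?E (birkhoff_sum T f n) x = (\<Sum>k<K. ?E (?c k) x) + ?E ?r x"
      unfolding birkhoff_sum_f[of n _ K, abs_def] by eventually_elim simp
    then have "L2_norm M (?E (birkhoff_sum T f n)) = L2_norm M (\<lambda>x. (\<Sum>k<K. ?E (?c k) x) + ?E ?r x)"
      by (intro L2_norm_cong_AE) auto
    also have "\<dots> \<le> L2_norm M (\<lambda>x. \<Sum>k<K. ?E (?c k) x) + L2_norm M (?E ?r)"
      by (intro L2_norm_add_le square_integrable_sum siE)
    also have "\<dots> \<le> (\<Sum>k<K. L2_norm M (?E (?c k))) + L2_norm M ?r"
      by (intro add_mono L2_norm_sum_le L2_norm_real_cond_exp_le subalgebra_past siE si)
    also have "\<dots> \<le> (\<Sum>k<K. ?B k) + real n * tail K"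
      by (intro add_mono sum_mono L2_norm_birkhoff_sum_remainder
          L2_norm_cond_exp_birkhoff_sum_moving_average std s_nonneg m_pos)
    also have "(\<Sum>k<K. ?B k) \<le> suminf ?B"
      by (intro sum_le_suminf sm B_nonneg) auto
    finally show ?thesis by simp
  qed
  moreover have "(\<lambda>K. suminf ?B + real n * tail K) \<longlonglongrightarrow> suminf ?B + real n * 0"
    by (intro tendsto_intros tail_tendsto)
  ultimately show "L2_norm M (?E (birkhoff_sum T f n)) \<le> suminf ?B"
    using LIMSEQ_le_const[of "\<lambda>K. suminf ?B + real n * tail K" "suminf ?B"] by auto
qed

text \<open>The relative L2 error of replacing \<open>birkhoff_sum T f n\<close> by
  \<open>s k\<close> times the sum of \<open>\<phi> k\<close> over \<open>n\<close> coordinates,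
  which has norm \<open>s k * sqrt n\<close>. The numerator collects the main terms of the
  components before \<open>k\<close>, the boundary terms of the components up to \<open>k\<close>,
  and everything after \<open>k\<close>.\<close>

definition error :: "nat \<Rightarrow> nat \<Rightarrow> real" where
  "error k n = ((\<Sum>j<k. s j) * sqrt (real n) + (\<Sum>j<Suc k. 2 * real (m j) * s j) + real n * tail (Suc k))
    / (s k * sqrt (real n))"

lemma L2_norm_birkhoff_sum_f_diff:
  assumes n: "0 < n"
  shows "L2_norm M (\<lambda>x. birkhoff_sum T f n x - s k * (\<Sum>i<n. \<phi> k (x (int i)))) \<le> error k n * (s k * sqrt (real n))"
proof -
  let ?r = "birkhoff_sum T (\<lambda>x. f x - (\<Sum>k<Suc k. component k x)) n"
  let ?c = "\<lambda>k. birkhoff_sum T (component k) n"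
  let ?d = "\<lambda>x. ?c k x - s k * (\<Sum>i<n. \<phi> k (x (int i)))"
  have si: "square_integrable M (?c k)" "square_integrable M ?r" "square_integrable M ?d" for k
    by (intro square_integrable_birkhoff_sum square_integrable_component square_integrable_remainder
        square_integrable_diff square_integrable_cmult square_integrable_sum_coordinates std)+
  have "L2_norm M (\<lambda>x. birkhoff_sum T f n x - s k * (\<Sum>i<n. \<phi> k (x (int i))))
      = L2_norm M (\<lambda>x. ((\<Sum>j<k. ?c j x) + ?d x) + ?r x)"
    by (simp add: birkhoff_sum_f[of n _ "Suc k"] algebra_simps)
  also have "\<dots> \<le> L2_norm M (\<lambda>x. (\<Sum>j<k. ?c j x) + ?d x) + L2_norm M ?r"
    by (intro L2_norm_add_le square_integrable_add square_integrable_sum si)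
  also have "\<dots> \<le> (L2_norm M (\<lambda>x. \<Sum>j<k. ?c j x) + L2_norm M ?d) + L2_norm M ?r"
    by (intro add_mono L2_norm_add_le square_integrable_sum si order_refl)
  also have "\<dots> \<le> ((\<Sum>j<k. L2_norm M (?c j)) + L2_norm M ?d) + L2_norm M ?r"
    by (intro add_mono L2_norm_sum_le si order_refl)
  also have "\<dots> \<le> ((\<Sum>j<k. s j * sqrt (real n) + 2 * real (m j) * s j) + 2 * real (m k) * s k) + real n * tail (Suc k)"
    by (intro add_mono sum_mono L2_norm_birkhoff_sum_remainder L2_norm_birkhoff_sum_moving_average_le
        L2_norm_birkhoff_sum_moving_average_diff std s_nonneg m_pos)
  also have "\<dots> = error k n * (s k * sqrt (real n))"
    using s_pos[of k] n by (simp add: error_def sum.distrib sum_distrib_right)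
  finally show ?thesis .
qed

lemma char_sum_coordinates:
  "char (distr M borel (\<lambda>x. \<Sum>i<n. \<phi> k (x (int i)))) t = char (distr N borel (\<phi> k)) t ^ n"
proof -
  have ind: "indep_vars (\<lambda>_. borel) (\<lambda>i x. \<phi> k (x i)) (int ` {..<n})"
    by (rule indep_coordinates_compose[OF \<phi>_measurable])
  have "char (distr M borel (\<lambda>x. \<phi> k (x i))) t = char (distr N borel (\<phi> k)) t" for i
  proof -
    have "distr M borel (\<phi> k \<circ> (\<lambda>x. x i)) = distr (distr M N (\<lambda>x. x i)) borel (\<phi> k)"
      by (rule distr_distr[symmetric, OF \<phi>_measurable measurable_coordinate])
    then show ?thesis by (simp add: distr_coordinate comp_def)
  qed
  then show ?thesis
    using char_distr_sum[OF ind, of t] by (simp add: sum.reindex prod.reindex card_image)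
qed

text \<open>After normalization the factor \<open>s k\<close> cancels from the approximating
  variable, leaving a sum of \<open>n\<close> independent copies of \<open>\<phi> k\<close> divided
  by \<open>sqrt n\<close>; its characteristic function is an \<open>n\<close>-th power.\<close>

lemma
  assumes n: "0 < n" and e: "error k n < 1"
  shows L2_norm_birkhoff_sum_f_pos: "0 < L2_norm M (birkhoff_sum T f n)"
    and char_normalized_law: "cmod (char (normalized_law M T f n) t
      - char (distr N borel (\<phi> k)) (t / sqrt (real n)) ^ n) \<le> 2 * \<bar>t\<bar> * error k n"
proof -
  let ?X = "birkhoff_sum T f n"
  let ?Y = "\<lambda>x. s k * (\<Sum>i<n. \<phi> k (x (int i)))"
  let ?a = "s k * sqrt (real n)"
  have X: "square_integrable M ?X" by (intro square_integrable_birkhoff_sum square_integrable_f)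
  have Y: "square_integrable M ?Y" by (intro square_integrable_cmult square_integrable_sum_coordinates std)
  have "L2_norm M ?Y = \<bar>s k\<bar> * sqrt (real (card {..<n}))"
    unfolding L2_norm_cmult by (subst L2_norm_sum_coordinates_inj[OF std]) (auto simp: inj_on_def)
  then have a: "L2_norm M ?Y = ?a" using s_pos[of k] by simp
  have a0: "0 < ?a" using s_pos[of k] n by simp
  note norm = L2_norm_normalize[OF X Y a a0 L2_norm_birkhoff_sum_f_diff[OF n] e]
  show "0 < L2_norm M (birkhoff_sum T f n)" by (rule norm)
  let ?Z = "\<lambda>x. \<Sum>i<n. \<phi> k (x (int i))"
  have [measurable]: "?Z \<in> borel_measurable M"
    by (rule square_integrable_measurable[OF square_integrable_sum_coordinates[OF std]])
  have "char (distr M borel (\<lambda>x. ?Y x / ?a)) t = (\<integral>x. iexp (t * (?Y x / ?a)) \<partial>M)"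
    by (simp add: char_def integral_distr)
  also have "\<dots> = (\<integral>x. iexp ((t / sqrt (real n)) * ?Z x) \<partial>M)"
    using s_pos[of k] by simp
  also have "\<dots> = char (distr M borel ?Z) (t / sqrt (real n))"
    by (simp add: char_def integral_distr)
  also have "\<dots> = char (distr N borel (\<phi> k)) (t / sqrt (real n)) ^ n"
    by (rule char_sum_coordinates)
  finally have Z: "char (distr M borel (\<lambda>x. ?Y x / ?a)) t = char (distr N borel (\<phi> k)) (t / sqrt (real n)) ^ n" .
  have "cmod (char (normalized_law M T f n) t - char (distr M borel (\<lambda>x. ?Y x / ?a)) t)
      \<le> \<bar>t\<bar> * L2_norm M (\<lambda>x. ?X x / L2_norm M ?X - ?Y x / ?a)"
    unfolding normalized_law_def
    by (intro norm_char_diff_le_L2_norm square_integrable_divide X Y)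
  also have "\<dots> \<le> \<bar>t\<bar> * (2 * error k n)"
    by (intro mult_left_mono norm) simp
  finally show "cmod (char (normalized_law M T f n) t
      - char (distr N borel (\<phi> k)) (t / sqrt (real n)) ^ n) \<le> 2 * \<bar>t\<bar> * error k n"
    unfolding Z by (simp only: mult_ac)
qed

lemma real_distribution_normalized_law: "real_distribution (normalized_law M T f n)"
  unfolding normalized_law_def
  by (intro real_distribution_distr square_integrable_measurable square_integrable_divide
      square_integrable_birkhoff_sum square_integrable_f)

end

section \<open>Weighted sums and three-point laws\<close>

text \<open>With \<open>n = Suc i\<close> this is the bound on the conditional norm for one moving
  average of length \<open>m\<close> and factor 1, divided by \<open>n powr (3 / 2)\<close>.\<close>

definition block_weight :: "nat \<Rightarrow> nat \<Rightarrow> real" where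
  "block_weight m i = real (min (Suc i) m) / (sqrt (real m) * real (Suc i) powr (3 / 2))"

lemma block_weight_nonneg: "0 \<le> block_weight m i"
  by (simp add: block_weight_def)

lemma powr_three_halves: "0 < x \<Longrightarrow> x powr (3 / 2) = x * sqrt x" for x :: real
  using powr_add[of x 1 "1 / 2"] by (simp add: powr_half_sqrt)

lemma block_weight_le: "block_weight m i \<le> 1 / sqrt (real m)"
proof (cases "m = 0")
  case False
  have "real (min (Suc i) m) \<le> real (Suc i) * 1" by simp
  also have "\<dots> \<le> real (Suc i) * sqrt (real (Suc i))" by (intro mult_left_mono) auto
  also have "\<dots> = real (Suc i) powr (3 / 2)" by (subst powr_three_halves) auto
  finally show ?thesis
    using False unfolding block_weight_def by (simp add: divide_simps)
qed (simp add: block_weight_def)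

text \<open>Telescoping substitutes for comparing sums of \<open>x powr (-1/2)\<close> and
  \<open>x powr (-3/2)\<close> with integrals. Both rest on \<open>sqrt (x + 1) - sqrt x\<close>
  being the reciprocal of \<open>sqrt x + sqrt (x + 1)\<close>.\<close>

lemma sqrt_increment_bounds:
  fixes x :: real
  assumes "0 < x"
  shows "1 / sqrt (x + 1) \<le> 2 * (sqrt (x + 1) - sqrt x)"
    and "1 / ((x + 1) * sqrt (x + 1)) \<le> 2 * (1 / sqrt x - 1 / sqrt (x + 1))"
proof -
  define a b where "a = sqrt x" and "b = sqrt (x + 1)"
  have ab: "0 < a" "a \<le> b" "0 < b" "b\<^sup>2 = x + 1" "a\<^sup>2 = x" using assms by (auto simp: a_def b_def)
  have d: "b - a = 1 / (a + b)"
  proof -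
    have "(b - a) * (a + b) = 1" using ab(4,5) by (simp add: power2_eq_square algebra_simps)
    then show ?thesis using ab by (simp add: eq_divide_eq)
  qed
  have "1 / b \<le> 2 / (a + b)" using ab by (simp add: field_simps)
  then show "1 / sqrt (x + 1) \<le> 2 * (sqrt (x + 1) - sqrt x)"
    using d by (simp add: a_def b_def)
  have "a * (a + b) \<le> b * (2 * b)" using ab by (intro mult_mono) auto
  then have "2 / (b * (2 * b)) \<le> 2 / (a * (a + b))" using ab by (intro divide_left_mono) auto
  then have "1 / (b * b) \<le> 2 / (a * (a + b))" by simp
  then have "1 / (b * b) / b \<le> 2 / (a * (a + b)) / b" using ab by (intro divide_right_mono) auto
  also have "2 / (a * (a + b)) / b = 2 * ((b - a) / (a * b))" by (simp add: d)
  also have "(b - a) / (a * b) = 1 / a - 1 / b" using ab by (simp add: field_simps)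
  finally have "1 / (b\<^sup>2 * b) \<le> 2 * (1 / a - 1 / b)" by (simp add: power2_eq_square)
  then show "1 / ((x + 1) * sqrt (x + 1)) \<le> 2 * (1 / sqrt x - 1 / sqrt (x + 1))"
    unfolding ab(4) by (simp add: a_def b_def)
qed

text \<open>With \<open>n = Suc i\<close>, the weight is \<open>1 / sqrt (n * m)\<close> up to
  \<open>n = m\<close> and \<open>sqrt m * n powr (-3/2)\<close> beyond. Each range contributes at
  most 2, uniformly in \<open>m\<close>.\<close>

lemma sum_block_weight_le:
  assumes m: "0 < m"
  shows "(\<Sum>i<Q. block_weight m i) \<le> 4"
proof -
  have k1: "block_weight m i = 1 / sqrt (real (Suc i)) / sqrt (real m)" if "i < m" for i
    using that unfolding block_weight_def by (subst powr_three_halves) (auto simp: min_def)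
  have k2: "block_weight m i = sqrt (real m) * (1 / (real (Suc i) * sqrt (real (Suc i))))" if "m \<le> i" for i
  proof -
    have "block_weight m i = real m / sqrt (real m) / (real (Suc i) * sqrt (real (Suc i)))"
      using that unfolding block_weight_def by (subst powr_three_halves) (auto simp: min_def)
    then show ?thesis by (simp add: real_div_sqrt)
  qed
  have small: "(\<Sum>i<Q. block_weight m i) \<le> 2 * sqrt (real Q) / sqrt (real m)" if "Q \<le> m" for Q
    using that
  proof (induction Q)
    case (Suc Q)
    have "1 / sqrt (real (Suc Q)) \<le> 2 * (sqrt (real (Suc Q)) - sqrt (real Q))"
      \<comment> \<open>At \<open>Q = 0\<close> the increment bound does not apply; there the
        inequality reads \<open>1 \<le> 2\<close>.\<close>
      using sqrt_increment_bounds(1)[of "real Q"] by (cases "Q = 0") (auto simp: add.commute)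
    then have "block_weight m Q \<le> 2 * (sqrt (real (Suc Q)) - sqrt (real Q)) / sqrt (real m)"
      using Suc.prems by (subst k1) (simp, rule divide_right_mono, simp_all)
    with Suc show ?case by (simp add: diff_divide_distrib right_diff_distrib)
  qed simp
  \<comment> \<open>At \<open>d = 0\<close> the right side is 2, the bound for the first range. The
    subtracted term is the part of the telescoping tail not yet summed.\<close>
  have large: "(\<Sum>i<m + d. block_weight m i) \<le> 4 - 2 * sqrt (real m) / sqrt (real (m + d))" for d
  proof (induction d)
    case 0
    then show ?case using small[of m] m by simp
  next
    case (Suc d)
    have "block_weight m (m + d) \<le> sqrt (real m) * (2 * (1 / sqrt (real (m + d)) - 1 / sqrt (real (Suc (m + d)))))"
      using sqrt_increment_bounds(2)[of "real (m + d)"] m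
      by (subst k2) (simp, rule mult_left_mono, simp_all add: add.commute)
    with Suc show ?case by (simp add: algebra_simps)
  qed
  show ?thesis
  proof (cases "Q \<le> m")
    case True
    have "2 * sqrt (real Q) / sqrt (real m) \<le> 2" using True m by (simp add: divide_le_eq)
    then show ?thesis using small[OF True] by linarith
  next
    case False
    then have "m + (Q - m) = Q" by simp
    moreover have "0 \<le> 2 * sqrt (real m) / sqrt (real Q)" by simp
    ultimately show ?thesis using large[of "Q - m"] by (simp only:)
  qed
qed

text \<open>The weights of the first \<open>n0\<close> indices are at most \<open>1 / sqrt m\<close>
  each, so with \<open>c\<close> bounded their total falls below \<open>e / 2\<close> for large
  \<open>m\<close>. Beyond \<open>n0\<close> the factor \<open>c\<close> is below
  \<open>e / 8\<close>, and the total weight is at most 4.\<close>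

lemma eventually_weighted_block_weight_le:
  fixes c :: "nat \<Rightarrow> real"
  assumes pos: "\<And>n. n \<ge> 1 \<Longrightarrow> c n > 0" and lim: "c \<longlonglongrightarrow> 0" and e: "0 < e"
  shows "eventually (\<lambda>m. \<forall>Q. (\<Sum>i<Q. c (Suc i) * block_weight m i) \<le> e) sequentially"
proof -
  have "eventually (\<lambda>n. c n < e / 8) sequentially"
    using e by (intro order_tendstoD[OF lim]) simp
  then obtain n0 where n0: "\<And>n. n0 \<le> n \<Longrightarrow> c n < e / 8" by (auto simp: eventually_sequentially)
  have "Bseq c" using lim by (intro convergent_imp_Bseq convergentI)
  then obtain C where C: "0 < C" "\<And>n. norm (c n) \<le> C" by (auto simp: Bseq_def)
  have "(\<lambda>m. real n0 * C * (1 / sqrt (real m))) \<longlonglongrightarrow> real n0 * C * 0"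
    by (intro tendsto_mult_left real_tendsto_divide_at_top[OF tendsto_const]
        filterlim_at_top_imp_at_infinity filterlim_compose[OF sqrt_at_top filterlim_real_sequentially])
  then have "eventually (\<lambda>m. real n0 * C * (1 / sqrt (real m)) < e / 2) sequentially"
    using e by (intro order_tendstoD) auto
  with eventually_gt_at_top[of "0::nat"] show ?thesis
  proof eventually_elim
    case (elim m)
    show ?case
    proof
      fix Q
      have "(\<Sum>i<Q. c (Suc i) * block_weight m i) \<le>
          (\<Sum>i<Q. (if i \<in> {..<n0} then C * (1 / sqrt (real m)) else 0) + e / 8 * block_weight m i)"
      proof (intro sum_mono)
        fix i
        show "c (Suc i) * block_weight m i \<le>
            (if i \<in> {..<n0} then C * (1 / sqrt (real m)) else 0) + e / 8 * block_weight m i"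
        proof (cases "i < n0")
          case True
          have "c (Suc i) * block_weight m i \<le> C * (1 / sqrt (real m))"
            using C pos[of "Suc i"] C(2)[of "Suc i"] by (intro mult_mono block_weight_le block_weight_nonneg) auto
          moreover have "0 \<le> e / 8 * block_weight m i" using e block_weight_nonneg[of m i] by simp
          ultimately show ?thesis using True by simp
        next
          case False
          then have "c (Suc i) * block_weight m i \<le> e / 8 * block_weight m i"
            using n0[of "Suc i"] by (intro mult_right_mono block_weight_nonneg) auto
          with False show ?thesis by simp
        qed
      qed
      also have "\<dots> = (\<Sum>i\<in>{..<Q} \<inter> {..<n0}. C * (1 / sqrt (real m))) + e / 8 * (\<Sum>i<Q. block_weight m i)"
        by (simp only: sum.distrib sum_distrib_left sum.inter_restrict[OF finite_lessThan])
      also have "\<dots> \<le> (\<Sum>i<n0. C * (1 / sqrt (real m))) + e / 8 * 4"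
        using C(1) e sum_block_weight_le[OF elim(1), of Q] by (intro add_mono sum_mono2 mult_left_mono) auto
      also have "\<dots> \<le> e"
        using elim(2) by (simp only: sum_constant card_lessThan mult.assoc)
      finally show "(\<Sum>i<Q. c (Suc i) * block_weight m i) \<le> e" .
    qed
  qed
qed

text \<open>The first Bernoulli variable decides whether the value is nonzero and the second is a
  fair sign; the size \<open>1 / sqrt p\<close> makes the variance 1. As an image of a distribution
  on a finite type, the law turns every integral into a finite sum.\<close>

definition three_point :: "real \<Rightarrow> real measure" where
  "three_point p = distr (measure_pmf (pair_pmf (bernoulli_pmf p) (bernoulli_pmf (1 / 2)))) borel
    (\<lambda>(b, c). if b then (if c then 1 else - 1) / sqrt p else 0)"

lemma sets_three_point [simp, measurable_cong]: "sets (three_point p) = sets borel"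
  by (simp add: three_point_def)

lemma space_three_point [simp]: "space (three_point p) = UNIV"
  by (simp add: three_point_def)

lemma prob_space_three_point: "prob_space (three_point p)"
  unfolding three_point_def by (rule prob_space.prob_space_distr) (auto intro: prob_space_measure_pmf)

lemma
  fixes g :: "real \<Rightarrow> 'c :: {banach, second_countable_topology}"
  assumes p: "0 \<le> p" "p \<le> 1" and g: "g \<in> borel_measurable borel"
  shows integrable_three_point: "integrable (three_point p) g"
    and integral_three_point: "(\<integral>y. g y \<partial>three_point p)
      = (1 - p) *\<^sub>R g 0 + (p / 2) *\<^sub>R (g (1 / sqrt p) + g (- 1 / sqrt p))"
proof -
  let ?q = "pair_pmf (bernoulli_pmf p) (bernoulli_pmf (1 / 2))"
  let ?h = "\<lambda>(b, c). if b then (if c then 1 else - 1) / sqrt p else 0"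
  have "integrable (measure_pmf ?q) (\<lambda>x. g (?h x))"
    by (rule integrable_measure_pmf_finite) (rule finite)
  then show "integrable (three_point p) g"
    unfolding three_point_def using g by (simp add: integrable_distr_eq)
  have "(\<integral>y. g y \<partial>three_point p) = (\<integral>x. g (?h x) \<partial>measure_pmf ?q)"
    unfolding three_point_def using g by (simp add: integral_distr)
  also have "\<dots> = (\<Sum>x\<in>UNIV. pmf ?q x *\<^sub>R g (?h x))"
    by (rule integral_measure_pmf) auto
  also have "\<dots> = (\<Sum>b\<in>UNIV. \<Sum>c\<in>UNIV. pmf ?q (b, c) *\<^sub>R g (?h (b, c)))"
    by (simp only: sum.cartesian_product UNIV_Times_UNIV) (intro sum.cong, auto)
  also have "\<dots> = (1 - p) *\<^sub>R g 0 + (p / 2) *\<^sub>R (g (1 / sqrt p) + g (- 1 / sqrt p))"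
    using p by (simp add: UNIV_bool pmf_pair scaleR_add_right flip: scaleR_add_left)
  finally show "(\<integral>y. g y \<partial>three_point p)
      = (1 - p) *\<^sub>R g 0 + (p / 2) *\<^sub>R (g (1 / sqrt p) + g (- 1 / sqrt p))" .
qed

lemma standardized_three_point:
  assumes p: "0 < p" "p \<le> 1"
  shows "standardized (three_point p) (\<lambda>y. y)"
  unfolding standardized_def square_integrable_def
  using p by (simp add: integrable_three_point integral_three_point power_divide)

lemma char_three_point:
  assumes p: "0 < p" "p \<le> 1"
  shows "char (three_point p) t = of_real (1 - p * (1 - cos (t / sqrt p)))"
proof -
  have "char (three_point p) t = (1 - p) *\<^sub>R iexp (t * 0)
      + (p / 2) *\<^sub>R (iexp (t * (1 / sqrt p)) + iexp (t * (- 1 / sqrt p)))"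
    unfolding char_def using p by (intro integral_three_point) auto
  also have "\<dots> = of_real (1 - p * (1 - cos (t / sqrt p)))"
    by (rule complex_eqI) (simp_all add: Re_exp Im_exp algebra_simps)
  finally show ?thesis .
qed

text \<open>The regime of small \<open>n * p\<close>, where a sum of \<open>n\<close> copies is
  mostly zero. For numbers of modulus at most 1, the \<open>n\<close>-th powers differ by at most
  \<open>n\<close> times the difference of the numbers.\<close>

lemma char_three_point_power_diff:
  assumes p: "0 < p" "p \<le> 1"
  shows "cmod (char (three_point p) t ^ n - 1) \<le> 2 * (real n * p)"
proof -
  have b: "0 \<le> 1 - cos (t / sqrt p)" "1 - cos (t / sqrt p) \<le> 2"
    using cos_le_one[of "t / sqrt p"] cos_ge_minus_one[of "t / sqrt p"] by linarith+
  have b2: "p * (1 - cos (t / sqrt p)) \<le> p * 2" "0 \<le> p * (1 - cos (t / sqrt p))"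
    using p b by (auto intro: mult_left_mono)
  have "cmod (char (three_point p) t ^ n - 1 ^ n) \<le> real n * cmod (char (three_point p) t - 1)"
  proof (rule norm_power_diff)
    show "cmod (char (three_point p) t) \<le> 1"
      unfolding char_three_point[OF p] norm_of_real using b2 p by linarith
  qed simp
  also have "char (three_point p) t - 1 = - of_real (p * (1 - cos (t / sqrt p)))"
    unfolding char_three_point[OF p] by simp
  also have "cmod \<dots> = p * (1 - cos (t / sqrt p))"
    unfolding norm_minus_cancel norm_of_real using b2 by simp
  also have "real n * \<dots> \<le> real n * (p * 2)"
    using b2 by (intro mult_left_mono) auto
  finally show ?thesis by (simp add: mult_ac)
qed

text \<open>The regime of large \<open>n * p\<close>, where \<open>x\<close> is close to
  \<open>t\<^sup>2 / 2\<close>. With \<open>u = x / n\<close> the two quantities are the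
  \<open>n\<close>-th powers of \<open>1 - u\<close> and \<open>exp (- u)\<close>, which differ by
  at most \<open>u\<^sup>2\<close>.\<close>

lemma char_three_point_power_exp:
  assumes p: "0 < p" "p \<le> 1" and n: "0 < n" and x: "x = real n * p * (1 - cos (t / sqrt (real n * p)))"
  shows "cmod (char (three_point p) (t / sqrt (real n)) ^ n - of_real (exp (- x))) \<le> x\<^sup>2 / real n"
proof -
  define u where "u = x / real n"
  have u: "u = p * (1 - cos (t / sqrt (real n * p)))" using n by (simp add: u_def x)
  have b: "0 \<le> 1 - cos (t / sqrt (real n * p))" "1 - cos (t / sqrt (real n * p)) \<le> 2"
    using cos_le_one[of "t / sqrt (real n * p)"] cos_ge_minus_one[of "t / sqrt (real n * p)"] by linarith+
  have u0: "0 \<le> u" using p b by (simp add: u)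
  \<comment> \<open>Together with \<open>0 \<le> u\<close> this gives
    \<open>\<bar>1 - u\<bar> \<le> 1\<close>, as the comparison of powers requires.\<close>
  have u2: "u \<le> 2" using p b mult_mono[of p 1 "1 - cos (t / sqrt (real n * p))" 2] by (simp add: u)
  have "char (three_point p) (t / sqrt (real n)) = of_real (1 - u)"
    by (simp add: char_three_point[OF p] u real_sqrt_mult)
  moreover have "exp (- x) = exp (- u) ^ n"
    using n by (simp add: u_def flip: exp_of_nat_mult)
  ultimately have "cmod (char (three_point p) (t / sqrt (real n)) ^ n - of_real (exp (- x)))
      = \<bar>(1 - u) ^ n - exp (- u) ^ n\<bar>"
    by (simp only: norm_of_real flip: of_real_power of_real_diff)
  also have "\<dots> \<le> real n * \<bar>(1 - u) - exp (- u)\<bar>"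
    using norm_power_diff[of "1 - u" "exp (- u)" n] u0 u2 by simp
  also have "\<bar>(1 - u) - exp (- u)\<bar> \<le> u\<^sup>2"
  proof -
    have "1 - u \<le> exp (- u)" using exp_ge_add_one_self[of "- u"] by simp
    moreover have "exp (- u) \<le> 1 - u + u\<^sup>2"
    proof -
      have "exp (- u) = 1 / exp u" by (simp add: exp_minus divide_inverse)
      also have "\<dots> \<le> 1 / (1 + u)" using u0 exp_ge_add_one_self[of u] by (intro divide_left_mono) auto
      also have "\<dots> \<le> 1 - u + u\<^sup>2"
      proof -
        have "(1 - u + u\<^sup>2) * (1 + u) = 1 + u ^ 3"
          by (simp add: power2_eq_square power3_eq_cube algebra_simps)
        then have "1 \<le> (1 - u + u\<^sup>2) * (1 + u)" using u0 by simp
        then show ?thesis using u0 by (simp add: pos_divide_le_eq)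
      qed
      finally show ?thesis .
    qed
    ultimately show ?thesis by (simp add: abs_le_iff)
  qed
  also have "real n * u\<^sup>2 = x\<^sup>2 / real n"
    using n by (simp add: u_def power2_eq_square)
  finally show ?thesis by (simp add: mult_left_mono)
qed

section \<open>Choice of the scales\<close>

text \<open>The factors grow by \<open>(k + 1)\<^sup>2\<close> at each step, so that each one
  exceeds \<open>k\<close> times the sum of its predecessors.\<close>

definition sd :: "nat \<Rightarrow> nat" where
  "sd k = (fact k)\<^sup>2"

text \<open>A perfect square, so that its root is exactly \<open>(k + 1)\<^sup>2 * sd k * m\<close>;
  this root outweighs the boundary terms of all components up to \<open>k\<close>.\<close>

definition short_time :: "nat \<Rightarrow> nat \<Rightarrow> nat" where
  "short_time k m = ((k + 1)\<^sup>2 * sd k * m)\<^sup>2"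

text \<open>The ratio \<open>(k + 1)\<^sup>2\<close> of the two times leaves room for a probability
  \<open>p\<close> with \<open>long_time * p = k + 1\<close> and
  \<open>short_time * p = 1 / (k + 1)\<close>.\<close>

definition long_time :: "nat \<Rightarrow> nat \<Rightarrow> nat" where
  "long_time k m = (k + 1)\<^sup>2 * short_time k m"

lemma sd_pos [simp]: "0 < sd k"
  by (simp add: sd_def)

lemma sd_mono: "j \<le> k \<Longrightarrow> sd j \<le> sd k"
  unfolding sd_def by (intro power_mono fact_mono) auto

text \<open>The \<open>k\<close> summands are at most the last one, \<open>sd (k - 1)\<close>, and
  \<open>k\<^sup>2 * sd (k - 1) = sd k\<close>.\<close>

lemma sum_sd_le: "k * (\<Sum>j<k. sd j) \<le> sd k"
proof (cases k)
  case (Suc i)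
  have "(\<Sum>j<Suc i. sd j) \<le> (\<Sum>j<Suc i. sd i)" by (intro sum_mono sd_mono) simp
  then have "Suc i * (\<Sum>j<Suc i. sd j) \<le> Suc i * (Suc i * sd i)"
    by (intro mult_left_mono) simp_all
  also have "\<dots> = sd (Suc i)" by (simp add: sd_def power2_eq_square algebra_simps)
  finally show ?thesis using Suc by simp
qed simp

lemma short_time_mono: "j \<le> k \<Longrightarrow> m \<le> m' \<Longrightarrow> short_time j m \<le> short_time k m'"
  unfolding short_time_def by (intro power_mono mult_mono sd_mono) auto

lemma long_time_mono: "j \<le> k \<Longrightarrow> m \<le> m' \<Longrightarrow> long_time j m \<le> long_time k m'"
  unfolding long_time_def by (intro power_mono mult_mono short_time_mono) auto

lemma short_time_less:
  assumes "m \<le> m'" "0 < m"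
  shows "short_time k m < short_time (Suc k) m'"
proof -
  have "(k + 1)\<^sup>2 * sd k * m < (Suc k + 1)\<^sup>2 * sd k * m"
    using assms by (intro mult_strict_right_mono power_strict_mono) auto
  also have "\<dots> \<le> (Suc k + 1)\<^sup>2 * sd (Suc k) * m'"
    using assms by (intro mult_mono sd_mono) auto
  finally show ?thesis unfolding short_time_def by (intro power_strict_mono) auto
qed

lemma long_time_less:
  assumes "m \<le> m'" "0 < m"
  shows "long_time k m < long_time (Suc k) m'"
proof -
  have "long_time k m < (k + 1)\<^sup>2 * short_time (Suc k) m'"
    unfolding long_time_def using short_time_less[OF assms] by simp
  also have "\<dots> \<le> long_time (Suc k) m'"
    unfolding long_time_def by (intro mult_right_mono power_mono) auto
  finally show ?thesis .
qed

lemma sqrt_short_time: "sqrt (real (short_time k m)) = (real k + 1)\<^sup>2 * real (sd k) * real m"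
  by (simp add: short_time_def)

lemma short_time_pos: "0 < m \<Longrightarrow> 0 < short_time k m"
  by (simp add: short_time_def)

lemma short_le_long: "short_time k m \<le> long_time k m"
  by (simp add: long_time_def)

text \<open>Given the scales chosen so far, each requirement on the next one holds for all large
  values, so dependent choice applies. The weight bound will give the summability of the weighted
  series, and the last condition makes all components after \<open>k\<close> negligible up to time
  \<open>long_time k (m k)\<close>.\<close>

lemma exists_scales:
  fixes c :: "nat \<Rightarrow> real"
  assumes pos: "\<And>n. n \<ge> 1 \<Longrightarrow> c n > 0" and lim: "c \<longlonglongrightarrow> 0"
  obtains m :: "nat \<Rightarrow> nat"
  where "\<And>k. 0 < m k" "\<And>k. m k \<le> m (Suc k)"
    and "\<And>k Q. real (sd k) * (\<Sum>i<Q. c (Suc i) * block_weight (m k) i) \<le> (1 / 2) ^ k"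
    and "\<And>k. real (long_time k (m k)) * (real (sd (Suc k)) / sqrt (real (m (Suc k)))) \<le> (1 / 2) ^ Suc k"
proof -
  let ?P = "\<lambda>k m. 0 < m \<and> (\<forall>Q. real (sd k) * (\<Sum>i<Q. c (Suc i) * block_weight m i) \<le> (1 / 2) ^ k)"
  let ?Q = "\<lambda>k m m'. m \<le> m' \<and>
    real (long_time k m) * (real (sd (Suc k)) / sqrt (real m')) \<le> (1 / 2) ^ Suc k"
  have P: "eventually (?P k) sequentially" for k
  proof -
    have "eventually (\<lambda>m. \<forall>Q. (\<Sum>i<Q. c (Suc i) * block_weight m i) \<le> (1 / 2) ^ k / real (sd k)) sequentially"
      using pos lim by (intro eventually_weighted_block_weight_le) simp_all
    with eventually_gt_at_top[of 0] show ?thesis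
      by eventually_elim (simp add: pos_le_divide_eq mult.commute)
  qed
  have Q: "eventually (?Q k m) sequentially" for k m
  proof -
    have "(\<lambda>m'. real (long_time k m) * (real (sd (Suc k)) / sqrt (real m'))) \<longlonglongrightarrow> real (long_time k m) * 0"
      by (intro tendsto_mult_left real_tendsto_divide_at_top[OF tendsto_const]
        filterlim_compose[OF sqrt_at_top filterlim_real_sequentially])
    then have "eventually (\<lambda>m'. real (long_time k m) * (real (sd (Suc k)) / sqrt (real m')) < (1 / 2) ^ Suc k)
        sequentially"
      by (rule order_tendstoD) simp
    with eventually_ge_at_top[of m] show ?thesis by eventually_elim simp
  qed
  have "\<exists>m. \<forall>k. ?P k (m k) \<and> ?Q k (m k) (m (Suc k))"
  proof (rule dependent_nat_choice)
    show "\<exists>m. ?P 0 m" using eventually_happens'[OF _ P[of 0]] by simp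
    show "\<exists>m'. ?P (Suc k) m' \<and> ?Q k m m'" for k m
      using eventually_happens'[OF _ eventually_conj[OF P[of "Suc k"] Q[where k = k and m = m]]] by simp
  qed
  then show ?thesis using that by blast
qed

text \<open>One coordinate of the shift is itself a sequence with independent entries, the
  \<open>k\<close>-th of which serves as innovation of the \<open>k\<close>-th moving
  average.\<close>

lemma superposition_three_point:
  fixes m :: "nat \<Rightarrow> nat"
  assumes m_pos: "\<And>k. 0 < m k"
    and separated: "\<And>k. real (long_time k (m k)) * (real (sd (Suc k)) / sqrt (real (m (Suc k)))) \<le> (1 / 2) ^ Suc k"
  defines "p \<equiv> \<lambda>k. (real k + 1) / real (long_time k (m k))"
  defines "N \<equiv> PiM UNIV (\<lambda>k. three_point (p k))"
  shows "superposition N (\<lambda>k y. y k) (\<lambda>k. real (sd k)) m"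
    and "0 < p k" and "p k \<le> 1" and "distr N borel (\<lambda>y. y k) = three_point (p k)"
proof -
  have L_ge: "k + 1 \<le> long_time k (m k)" for k
  proof -
    have "(k + 1) * 1 \<le> (k + 1)\<^sup>2 * short_time k (m k)"
      using short_time_pos[OF m_pos[of k], of k] by (intro mult_mono) (auto simp: power2_eq_square)
    then show ?thesis by (simp add: long_time_def)
  qed
  have L_pos: "0 < long_time k (m k)" for k using L_ge[of k] by simp
  show p_pos: "0 < p k" for k using L_pos[of k] by (simp add: p_def)
  show p_le: "p k \<le> 1" for k
  proof -
    have "real (k + 1) \<le> real (long_time k (m k))" using L_ge[of k] by (simp only: of_nat_le_iff)
    then show ?thesis using L_pos[of k] by (simp add: p_def)
  qed
  interpret N: prob_space N unfolding N_def by (rule prob_space_PiM) (rule prob_space_three_point)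
  have comp: "(\<lambda>y. y k) \<in> measurable N (three_point (p k))" for k
    unfolding N_def by (rule measurable_component_singleton) simp
  have dist: "distr N (three_point (p k)) (\<lambda>y. y k) = three_point (p k)" for k
    unfolding N_def by (rule distr_PiM_component[OF prob_space_three_point]) simp
  show "distr N borel (\<lambda>y. y k) = three_point (p k)" for k
    using dist[of k] by (simp cong: distr_cong)
  show "superposition N (\<lambda>k y. y k) (\<lambda>k. real (sd k)) m"
  proof
    show "space N = UNIV" by (simp add: N_def space_PiM)
    show "0 < real (sd k)" "0 < m k" for k by (simp_all add: m_pos)
    show "standardized N (\<lambda>y. y k)" for k
    proof -
      have st: "standardized (three_point (p k)) (\<lambda>y. y)"
        by (rule standardized_three_point[OF p_pos p_le])
      then have si: "square_integrable (three_point (p k)) (\<lambda>y. y)" by (simp add: standardized_def)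
      have "square_integrable N (\<lambda>y. y k)"
        by (rule square_integrable_compose[OF comp dist si])
      moreover have "(\<integral>y. y k \<partial>N) = (\<integral>y. y \<partial>three_point (p k))"
        using integral_distr[OF comp, of "\<lambda>y. y" k] unfolding dist by simp
      moreover have "(\<integral>y. (y k)\<^sup>2 \<partial>N) = (\<integral>y. y\<^sup>2 \<partial>three_point (p k))"
        using integral_distr[OF comp, of "\<lambda>y. y\<^sup>2" k] unfolding dist by simp
      ultimately show ?thesis using st by (simp add: standardized_def)
    qed
    have "summable (\<lambda>k. real (sd (Suc k)) / sqrt (real (m (Suc k))))"
    proof (rule summable_comparison_test')
      show "summable (\<lambda>k. (1 / 2 :: real) ^ Suc k)" by (simp add: summable_geometric)
      fix k
      \<comment> \<open>Since \<open>long_time\<close> is at least 1, the separation condition alone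
        yields geometric decay of the norms from index 1 on.\<close>
      have "1 * (real (sd (Suc k)) / sqrt (real (m (Suc k))))
          \<le> real (long_time k (m k)) * (real (sd (Suc k)) / sqrt (real (m (Suc k))))"
        using L_pos[of k] by (intro mult_right_mono) auto
      then have "real (sd (Suc k)) / sqrt (real (m (Suc k))) \<le> (1 / 2) ^ Suc k"
        using separated[of k] by linarith
      then show "norm (real (sd (Suc k)) / sqrt (real (m (Suc k)))) \<le> (1 / 2) ^ Suc k"
        by (simp del: power_Suc)
    qed
    then show "summable (\<lambda>k. real (sd k) / sqrt (real (m k)))" by (rule summable_Suc_iff[THEN iffD1])
  qed
qed

text \<open>The identity \<open>1 - cos (2 * y) = 2 * (sin y)\<^sup>2\<close> with
  \<open>y = t / (2 * sqrt (k + 1))\<close> reduces the limit to \<open>sin y / y\<close> tending to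
  1. The case \<open>t = 0\<close> is separate because of the division by \<open>y\<close>.\<close>

lemma tendsto_rescaled_one_minus_cos:
  fixes t :: real
  shows "(\<lambda>k. (real k + 1) * (1 - cos (t / sqrt (real k + 1)))) \<longlonglongrightarrow> t\<^sup>2 / 2"
proof (cases "t = 0")
  case False
  define y where "y k = t / (2 * sqrt (real k + 1))" for k :: nat
  have y0: "y k \<noteq> 0" for k using False by (simp add: y_def)
  have "filterlim (\<lambda>k. real k + 1) at_top sequentially"
    using filterlim_tendsto_add_at_top[OF tendsto_const filterlim_real_sequentially, of 1]
    by (simp add: add.commute)
  then have "(\<lambda>k. t / 2 / sqrt (real k + 1)) \<longlonglongrightarrow> 0"
    by (intro real_tendsto_divide_at_top[OF tendsto_const] filterlim_compose[OF sqrt_at_top])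
  then have "y \<longlonglongrightarrow> 0" by (simp add: y_def[abs_def])
  then have "filterlim y (at 0) sequentially"
    using y0 by (simp add: filterlim_at)
  then have "(\<lambda>k. sin (y k) / y k) \<longlonglongrightarrow> 1"
    by (rule filterlim_compose[OF sinc_at_0])
  then have "(\<lambda>k. t\<^sup>2 / 2 * (sin (y k) / y k)\<^sup>2) \<longlonglongrightarrow> t\<^sup>2 / 2 * 1\<^sup>2"
    by (intro tendsto_intros)
  moreover have "(real k + 1) * (1 - cos (t / sqrt (real k + 1))) = t\<^sup>2 / 2 * (sin (y k) / y k)\<^sup>2" for k
  proof -
    have "(y k)\<^sup>2 * (4 * (real k + 1)) = t\<^sup>2"
      by (simp add: y_def power_divide power_mult_distrib)
    then have k: "real k + 1 = t\<^sup>2 / (4 * (y k)\<^sup>2)"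
      using y0[of k] by (simp add: field_simps)
    have "t / sqrt (real k + 1) = 2 * y k" by (simp add: y_def)
    then have "(real k + 1) * (1 - cos (t / sqrt (real k + 1))) = (real k + 1) * (2 * (sin (y k))\<^sup>2)"
      by (simp only: cos_double_sin) simp
    also have "\<dots> = t\<^sup>2 / 2 * (sin (y k) / y k)\<^sup>2"
      unfolding k by (simp add: power_divide)
    finally show ?thesis .
  qed
  ultimately show ?thesis by (simp only: power_one mult_1_right)
qed simp

section \<open>The counterexample: summability and the two limit laws\<close>

locale counterexample = superposition N "\<lambda>k y. y k" "\<lambda>k. real (sd k)" m
  for N :: "(nat \<Rightarrow> real) measure" and m :: "nat \<Rightarrow> nat" +
  fixes c :: "nat \<Rightarrow> real" and p :: "nat \<Rightarrow> real"
  assumes c_pos: "\<And>n. n \<ge> 1 \<Longrightarrow> c n > 0"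
    and m_mono: "\<And>k. m k \<le> m (Suc k)"
    and block_weight_sum: "\<And>k Q. real (sd k) * (\<Sum>i<Q. c (Suc i) * block_weight (m k) i) \<le> (1 / 2) ^ k"
    and separated: "\<And>k. real (long_time k (m k)) * (real (sd (Suc k)) / sqrt (real (m (Suc k)))) \<le> (1 / 2) ^ Suc k"
    and p: "\<And>k. p k = (real k + 1) / real (long_time k (m k))"
    and p_pos: "\<And>k. 0 < p k" and p_le: "\<And>k. p k \<le> 1"
    and law: "\<And>k. distr N borel (\<lambda>y. y k) = three_point (p k)"
begin

text \<open>All terms are nonnegative, so bounded partial sums suffice. Exchanging the finite sum
  over \<open>n\<close> with the series over \<open>k\<close> leaves for each \<open>k\<close> a
  weighted block sum, at most \<open>(1 / 2) ^ k\<close>, and these add up to 2.\<close>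

lemma summable_cond_exp:
  "summable (\<lambda>n. c (Suc n) * (L2_norm M (real_cond_exp M (past 0) (birkhoff_sum T f (Suc n)))
      / real (Suc n) powr (3 / 2)))"
proof (rule summableI_nonneg_bounded)
  let ?n = "\<lambda>n. L2_norm M (real_cond_exp M (past 0) (birkhoff_sum T f (Suc n)))"
  have c0: "0 \<le> c (Suc n)" for n using c_pos[of "Suc n"] by simp
  show "0 \<le> c (Suc n) * (?n n / real (Suc n) powr (3 / 2))" for n
    using c0[of n] by simp
  have eq: "real (sd k) * (c (Suc n) * block_weight (m k) n)
      = c (Suc n) / real (Suc n) powr (3 / 2) * (real (sd k) * real (min (Suc n) (m k)) / sqrt (real (m k)))" for k n
    by (simp add: block_weight_def field_simps)
  have sm: "summable (\<lambda>k. real (sd k) * (c (Suc n) * block_weight (m k) n))" for n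
    unfolding eq by (intro summable_mult summable_cond_exp_bound)
  show "(\<Sum>n<Q. c (Suc n) * (?n n / real (Suc n) powr (3 / 2))) \<le> 2" for Q
  proof -
    have "(\<Sum>n<Q. c (Suc n) * (?n n / real (Suc n) powr (3 / 2)))
        \<le> (\<Sum>n<Q. \<Sum>k. real (sd k) * (c (Suc n) * block_weight (m k) n))"
    proof (intro sum_mono)
      fix n
      have "c (Suc n) * (?n n / real (Suc n) powr (3 / 2)) = c (Suc n) / real (Suc n) powr (3 / 2) * ?n n"
        by simp
      also have "\<dots> \<le> c (Suc n) / real (Suc n) powr (3 / 2) *
          (\<Sum>k. real (sd k) * real (min (Suc n) (m k)) / sqrt (real (m k)))"
        using c0[of n] by (intro mult_left_mono L2_norm_cond_exp_birkhoff_sum_f) simp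
      also have "\<dots> = (\<Sum>k. real (sd k) * (c (Suc n) * block_weight (m k) n))"
        unfolding eq by (rule suminf_mult[OF summable_cond_exp_bound, symmetric])
      finally show "c (Suc n) * (?n n / real (Suc n) powr (3 / 2))
          \<le> (\<Sum>k. real (sd k) * (c (Suc n) * block_weight (m k) n))" .
    qed
    also have "\<dots> = (\<Sum>k. \<Sum>n<Q. real (sd k) * (c (Suc n) * block_weight (m k) n))"
      by (rule suminf_sum[OF sm, symmetric])
    also have "\<dots> \<le> (\<Sum>k. (1 / 2) ^ k)"
      using block_weight_sum[of _ Q]
      by (intro suminf_le summable_sum sm) (simp_all add: summable_geometric sum_distrib_left)
    also have "\<dots> = (2 :: real)" by (simp add: suminf_geometric)
    finally show ?thesis .
  qed
qed

abbreviation short :: "nat \<Rightarrow> nat" where "short k \<equiv> short_time k (m k)"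
abbreviation long :: "nat \<Rightarrow> nat" where "long k \<equiv> long_time k (m k)"

lemma m_mono': "j \<le> k \<Longrightarrow> m j \<le> m k"
  using lift_Suc_mono_le[of m, OF m_mono] .

text \<open>The separation condition couples consecutive scales only. As \<open>long\<close>
  increases, replacing \<open>long k\<close> by \<open>long (i + k)\<close> in the
  \<open>i\<close>-th term makes it applicable and yields a geometric series.\<close>

lemma long_tail_le: "real (long k) * tail (Suc k) \<le> 1"
proof -
  have sm: "summable (\<lambda>i. real (sd (i + Suc k)) / sqrt (real (m (i + Suc k))))"
    by (rule summable_ignore_initial_segment[OF summable_norms])
  have "real (long k) * tail (Suc k) = (\<Sum>i. real (long k) * (real (sd (i + Suc k)) / sqrt (real (m (i + Suc k)))))"
    unfolding tail_def by (rule suminf_mult[OF sm, symmetric])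
  also have "\<dots> \<le> (\<Sum>i. (1 / 2) ^ Suc i)"
  proof (rule suminf_le)
    fix i
    have "real (long k) * (real (sd (i + Suc k)) / sqrt (real (m (i + Suc k))))
        \<le> real (long (i + k)) * (real (sd (Suc (i + k))) / sqrt (real (m (Suc (i + k)))))"
      by (simp, intro divide_right_mono mult_right_mono of_nat_mono long_time_mono m_mono') auto
    also have "\<dots> \<le> (1 / 2) ^ Suc (i + k)" by (rule separated)
    also have "\<dots> \<le> (1 / 2) ^ Suc i" by (intro power_decreasing) auto
    finally show "real (long k) * (real (sd (i + Suc k)) / sqrt (real (m (i + Suc k)))) \<le> (1 / 2) ^ Suc i" .
  next
    show "summable (\<lambda>i. real (long k) * (real (sd (i + Suc k)) / sqrt (real (m (i + Suc k)))))"
      by (rule summable_mult[OF sm])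
    show "summable (\<lambda>i. (1 / 2 :: real) ^ Suc i)" by (simp add: summable_geometric)
  qed
  also have "\<dots> = (1 :: real)"
    using suminf_mult[of "\<lambda>i. (1 / 2 :: real) ^ i" "1 / 2"] by (simp add: summable_geometric suminf_geometric)
  finally show ?thesis .
qed

lemma tail_nonneg: "0 \<le> tail K"
  unfolding tail_def by (intro suminf_nonneg summable_ignore_initial_segment[OF summable_norms]) simp

text \<open>The components before \<open>k\<close> contribute \<open>1 / k\<close> by the growth of
  \<open>sd\<close>, the boundary terms \<open>2 / k\<close> because \<open>n\<close> is at least
  \<open>short k\<close>, and the later components \<open>1 / k\<close> because \<open>n\<close> is
  at most \<open>long k\<close>.\<close>

lemma error_le:
  assumes n: "short k \<le> n" "n \<le> long k" and k: "0 < k"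
  shows "error k n \<le> 4 / real k"
proof -
  define r where "r = sqrt (real n)"
  let ?s = "real (sd k)"
  have s1: "1 \<le> ?s" using sd_pos[of k] by linarith
  have m1: "1 \<le> real (m k)" using m_pos[of k] by linarith
  have r_ge: "(real k + 1)\<^sup>2 * ?s * real (m k) \<le> r"
    using n(1) unfolding r_def by (simp flip: sqrt_short_time)
  have k2: "real k \<le> (real k + 1)\<^sup>2" by (simp add: power2_eq_square algebra_simps)
  have kr: "real k \<le> r"
  proof -
    have "real k * 1 * 1 \<le> (real k + 1)\<^sup>2 * ?s * real (m k)"
      using k2 s1 m1 by (intro mult_mono) auto
    with r_ge show ?thesis by simp
  qed
  have r0: "0 < r" using kr k by simp
  have sr: "0 < ?s * r" using s1 r0 by simp
  have A: "(\<Sum>j<k. real (sd j)) * r / (?s * r) \<le> 1 / real k"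
  proof -
    have "real (k * (\<Sum>j<k. sd j)) \<le> ?s" by (intro of_nat_mono sum_sd_le)
    then have "(\<Sum>j<k. real (sd j)) * real k \<le> ?s" by (simp add: mult.commute)
    then have "(\<Sum>j<k. real (sd j)) / ?s \<le> 1 / real k"
      using s1 k by (simp add: divide_le_eq le_divide_eq)
    then show ?thesis using r0 by simp
  qed
  have B: "(\<Sum>j<Suc k. 2 * real (m j) * real (sd j)) / (?s * r) \<le> 2 / real k"
  proof -
    \<comment> \<open>There are \<open>k + 1\<close> boundary terms, each at most the
      \<open>k\<close>-th one; multiplied by \<open>k\<close> they stay below
      \<open>(k + 1)\<^sup>2\<close> times that term, hence below \<open>2 * r\<close>.\<close>
    have "(\<Sum>j<Suc k. 2 * real (m j) * real (sd j)) \<le> (\<Sum>j<Suc k. 2 * real (m k) * ?s)"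
      by (intro sum_mono mult_mono of_nat_mono m_mono' sd_mono) auto
    also have "\<dots> = (real k + 1) * (2 * real (m k) * ?s)" by simp
    finally have "(\<Sum>j<Suc k. 2 * real (m j) * real (sd j)) * real k
        \<le> (real k + 1) * (2 * real (m k) * ?s) * (real k + 1)"
      by (intro mult_mono) auto
    also have "\<dots> = 2 * ((real k + 1)\<^sup>2 * ?s * real (m k))"
      by (simp add: power2_eq_square)
    also have "\<dots> \<le> 2 * r" using r_ge by simp
    also have "\<dots> \<le> 2 * (?s * r)" using s1 r0 by simp
    finally show ?thesis using sr k by (simp add: divide_le_eq le_divide_eq)
  qed
  have C: "real n * tail (Suc k) / (?s * r) \<le> 1 / real k"
  proof -
    have "real n * tail (Suc k) \<le> real (long k) * tail (Suc k)"
      using n(2) by (intro mult_right_mono tail_nonneg) simp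
    also note long_tail_le
    finally have "real n * tail (Suc k) / (?s * r) \<le> 1 / (?s * r)"
      using sr by (intro divide_right_mono) auto
    also have "\<dots> \<le> 1 / real k"
    proof (rule divide_left_mono)
      have "1 * real k \<le> ?s * r" using s1 kr by (intro mult_mono) auto
      then show "real k \<le> ?s * r" by simp
    qed (use sr k in auto)
    finally show ?thesis .
  qed
  have "error k n = (\<Sum>j<k. real (sd j)) * r / (?s * r)
      + (\<Sum>j<Suc k. 2 * real (m j) * real (sd j)) / (?s * r) + real n * tail (Suc k) / (?s * r)"
    unfolding error_def r_def by (simp only: add_divide_distrib)
  also have "\<dots> \<le> 1 / real k + 2 / real k + 1 / real k"
    by (intro add_mono A B C)
  finally show ?thesis by (simp flip: add_divide_distrib)
qed

text \<open>In the window between the two times the normalized law differs from that of a single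
  normalized three-point sum by an error of order \<open>1 / k\<close> in characteristic functions,
  so Levy's continuity theorem reduces weak convergence to three-point sums. Starting at index 5
  makes \<open>4 / (k + 5) < 1\<close> for every \<open>k\<close>, which keeps all normalizing
  constants positive.\<close>

lemma
  assumes n: "\<And>k. short (k + 5) \<le> n k" "\<And>k. n k \<le> long (k + 5)"
  shows L2_norm_birkhoff_sum_pos: "0 < L2_norm M (birkhoff_sum T f (n k))"
    and weak_conv_normalized_law: "real_distribution \<mu> \<Longrightarrow>
      (\<And>t. (\<lambda>k. char (three_point (p (k + 5))) (t / sqrt (real (n k))) ^ n k) \<longlonglongrightarrow> char \<mu> t) \<Longrightarrow>
      weak_conv_m (\<lambda>k. normalized_law M T f (n k)) \<mu>"
proof -
  have n0: "0 < n k" for k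
    using short_time_pos[OF m_pos] n(1)[of k] by (rule less_le_trans)
  have e: "error (k + 5) (n k) \<le> 4 / real (k + 5)" for k
    by (rule error_le[OF n]) simp
  have "4 / real (k + 5) < 1" for k by simp
  with e have e1: "error (k + 5) (n k) < 1" for k by (rule le_less_trans)
  show "0 < L2_norm M (birkhoff_sum T f (n k))"
    by (rule L2_norm_birkhoff_sum_f_pos[OF n0 e1])
  assume \<mu>: "real_distribution \<mu>"
    and lim: "\<And>t. (\<lambda>k. char (three_point (p (k + 5))) (t / sqrt (real (n k))) ^ n k) \<longlonglongrightarrow> char \<mu> t"
  show "weak_conv_m (\<lambda>k. normalized_law M T f (n k)) \<mu>"
  proof (rule levy_continuity[OF real_distribution_normalized_law \<mu>])
    fix t
    let ?d = "\<lambda>k. char (normalized_law M T f (n k)) t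
      - char (three_point (p (k + 5))) (t / sqrt (real (n k))) ^ n k"
    have "?d \<longlonglongrightarrow> 0"
    proof (rule Lim_null_comparison)
      have "cmod (?d k) \<le> 2 * \<bar>t\<bar> * (4 / real (k + 5))" for k
        using char_normalized_law[OF n0 e1, of k t] mult_left_mono[OF e, of "2 * \<bar>t\<bar>" k]
        unfolding law by simp
      then show "eventually (\<lambda>k. norm (?d k) \<le> 2 * \<bar>t\<bar> * (4 / real (k + 5))) sequentially"
        by simp
      have "(\<lambda>k. 4 / real (k + 5)) \<longlonglongrightarrow> 0"
        using LIMSEQ_ignore_initial_segment[OF lim_const_over_n[of "4::real"], of 5] by simp
      then show "(\<lambda>k. 2 * \<bar>t\<bar> * (4 / real (k + 5))) \<longlonglongrightarrow> 0"
        by (rule tendsto_mult_right_zero)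
    qed
    from tendsto_add[OF this lim[of t]]
    show "(\<lambda>k. char (normalized_law M T f (n k)) t) \<longlonglongrightarrow> char \<mu> t" by simp
  qed
qed

lemma long_mult_p: "real (long k) * p k = real k + 1"
proof -
  have "0 < long k" using short_time_pos[OF m_pos[of k], of k] short_le_long by (rule less_le_trans)
  then show ?thesis by (simp add: p)
qed

text \<open>Here \<open>n * p = 1 / (k + 1)\<close> tends to 0. The normalized sums all have L2 norm
  1, yet their variance is carried by events of vanishing probability and is lost in the weak
  limit.\<close>

lemma weak_conv_short:
  "weak_conv_m (\<lambda>k. normalized_law M T f (short (k + 5))) (return borel 0)"
proof (rule weak_conv_normalized_law)
  show "real_distribution (return borel 0)"
    by (simp add: real_distribution_def real_distribution_axioms_def prob_space_return)
  fix t :: real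
  let ?d = "\<lambda>k. char (three_point (p (k + 5))) (t / sqrt (real (short (k + 5)))) ^ short (k + 5)"
  have "(\<lambda>k. ?d k - 1) \<longlonglongrightarrow> 0"
  proof (rule Lim_null_comparison)
    have sp: "real (short k) * p k = 1 / (real k + 1)" for k
    proof -
      have "(real k + 1)\<^sup>2 * (real (short k) * p k) = real k + 1"
        using long_mult_p[of k] by (simp add: long_time_def add.commute mult.assoc)
      then have "(real k + 1) * ((real k + 1) * (real (short k) * p k)) = (real k + 1) * 1"
        by (simp only: power2_eq_square mult.assoc mult_1_right)
      then have "(real k + 1) * (real (short k) * p k) = 1"
        by (subst (asm) mult_left_cancel) auto
      then show ?thesis by (simp add: eq_divide_eq mult.commute)
    qed
    have "norm (?d k - 1) \<le> 2 * (1 / (real (k + 5) + 1))" for k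
      using char_three_point_power_diff[OF p_pos p_le, of "k + 5" _ "short (k + 5)"] unfolding sp .
    then show "eventually (\<lambda>k. norm (?d k - 1) \<le> 2 * (1 / (real (k + 5) + 1))) sequentially"
      by simp
    show "(\<lambda>k. 2 * (1 / (real (k + 5) + 1))) \<longlonglongrightarrow> 0"
      using LIMSEQ_ignore_initial_segment[OF lim_const_over_n[of "2::real"], of 6]
      by (simp add: add.commute)
  qed
  then show "?d \<longlonglongrightarrow> char (return borel 0) t"
    by (simp add: char_def integral_return LIM_zero_iff)
qed (use short_le_long in auto)

text \<open>Here \<open>n * p = k + 1\<close> tends to infinity, and the exponent \<open>x k\<close>
  tends to \<open>t\<^sup>2 / 2\<close>, the exponent of the Gaussian characteristic
  function.\<close>

lemma weak_conv_long:
  "weak_conv_m (\<lambda>k. normalized_law M T f (long (k + 5))) std_normal_distribution"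
proof (rule weak_conv_normalized_law)
  show "real_distribution std_normal_distribution" by (rule real_dist_normal_dist)
  fix t :: real
  let ?d = "\<lambda>k. char (three_point (p (k + 5))) (t / sqrt (real (long (k + 5)))) ^ long (k + 5)"
  define x where "x k = (real k + 1) * (1 - cos (t / sqrt (real k + 1)))" for k :: nat
  have x_lim: "(\<lambda>k. x (k + 5)) \<longlonglongrightarrow> t\<^sup>2 / 2"
    unfolding x_def by (rule LIMSEQ_ignore_initial_segment[OF tendsto_rescaled_one_minus_cos])
  have inv: "(\<lambda>k. 1 / real (k + 5)) \<longlonglongrightarrow> 0"
    using LIMSEQ_ignore_initial_segment[OF lim_const_over_n[of "1::real"], of 5] by simp
  have "(\<lambda>k. ?d k - of_real (exp (- x (k + 5)))) \<longlonglongrightarrow> 0"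
  proof (rule Lim_null_comparison)
    have "norm (?d k - of_real (exp (- x (k + 5)))) \<le> (x (k + 5))\<^sup>2 * (1 / real (k + 5))" for k
    proof -
      \<comment> \<open>Because \<open>p\<close> is at most 1, the time is at least
        \<open>k + 5\<close>, so the error of the exponential approximation vanishes.\<close>
      have "real (k + 5) \<le> real (long (k + 5)) * p (k + 5)" unfolding long_mult_p by simp
      also have "\<dots> \<le> real (long (k + 5)) * 1" using p_le by (intro mult_left_mono) auto
      finally have L: "real (k + 5) \<le> real (long (k + 5))" by simp
      have "norm (?d k - of_real (exp (- x (k + 5)))) \<le> (x (k + 5))\<^sup>2 / real (long (k + 5))"
      proof (rule char_three_point_power_exp[OF p_pos p_le])
        show "0 < long (k + 5)" using L by linarith
        show "x (k + 5) = real (long (k + 5)) * p (k + 5) * (1 - cos (t / sqrt (real (long (k + 5)) * p (k + 5))))"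
          unfolding long_mult_p x_def ..
      qed
      also have "\<dots> \<le> (x (k + 5))\<^sup>2 / real (k + 5)"
        using L by (intro divide_left_mono) auto
      finally show ?thesis by simp
    qed
    then show "eventually (\<lambda>k. norm (?d k - of_real (exp (- x (k + 5)))) \<le> (x (k + 5))\<^sup>2 * (1 / real (k + 5))) sequentially"
      by simp
    show "(\<lambda>k. (x (k + 5))\<^sup>2 * (1 / real (k + 5))) \<longlonglongrightarrow> 0"
      using tendsto_mult[OF tendsto_power[OF x_lim, of 2] inv] by simp
  qed
  moreover have "(\<lambda>k. of_real (exp (- x (k + 5))) :: complex) \<longlonglongrightarrow> of_real (exp (- (t\<^sup>2 / 2)))"
    by (intro tendsto_intros x_lim)
  ultimately have "(\<lambda>k. (?d k - of_real (exp (- x (k + 5)))) + of_real (exp (- x (k + 5))))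
      \<longlonglongrightarrow> 0 + of_real (exp (- (t\<^sup>2 / 2)))"
    by (rule tendsto_add)
  then show "?d \<longlonglongrightarrow> char std_normal_distribution t"
    by (simp add: char_std_normal_distribution)
qed (use short_le_long in auto)

lemma strict_mono_short: "strict_mono (\<lambda>k. short (k + 5))"
  unfolding strict_mono_Suc_iff add_Suc by (intro allI short_time_less m_mono m_pos)

lemma strict_mono_long: "strict_mono (\<lambda>k. long (k + 5))"
  unfolding strict_mono_Suc_iff add_Suc by (intro allI long_time_less m_mono m_pos)

text \<open>At frequency 1 the characteristic functions take the values 1 and
  \<open>exp (- 1 / 2)\<close>.\<close>

lemma return_neq_std_normal: "return borel 0 \<noteq> std_normal_distribution"
proof
  assume "return borel (0::real) = std_normal_distribution"
  then have "char (return borel (0::real)) 1 = char std_normal_distribution 1" by simp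
  then show False
    by (simp add: char_std_normal_distribution) (simp add: char_def integral_return)
qed

end

theorem theorem2:
  fixes c :: "nat \<Rightarrow> real"
  assumes "\<And>n. n \<ge> 1 \<Longrightarrow> c n > 0"
    and "c \<longlonglongrightarrow> 0"
  shows "\<exists>(M :: (int \<Rightarrow> nat \<Rightarrow> real) measure) T (F :: int \<Rightarrow> (int \<Rightarrow> nat \<Rightarrow> real) measure) f.
      ergodic_dynamical_system M T
    \<and> (\<forall>i j. i \<le> j \<longrightarrow> sets (F i) \<subseteq> sets (F j))
    \<and> (\<forall>i. subalgebra M (F i))
    \<and> (\<forall>i. (\<lambda>A. T -` A \<inter> space M) ` sets (F i) = sets (F (i + 1)))
    \<and> f \<in> borel_measurable (F 0)
    \<and> integrable M (\<lambda>x. (f x)\<^sup>2)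
    \<and> (\<integral>x. f x \<partial>M) = 0
    \<and> summable (\<lambda>n. c (Suc n) * (L2_norm M (real_cond_exp M (F 0) (birkhoff_sum T f (Suc n)))
                                 / real (Suc n) powr (3 / 2)))
    \<and> (\<exists>n' n'' \<mu>' \<mu>''.
          strict_mono n' \<and> strict_mono n''
        \<and> (\<forall>k. n' k \<ge> 1 \<and> L2_norm M (birkhoff_sum T f (n' k)) > 0)
        \<and> (\<forall>k. n'' k \<ge> 1 \<and> L2_norm M (birkhoff_sum T f (n'' k)) > 0)
        \<and> real_distribution \<mu>' \<and> real_distribution \<mu>'' \<and> \<mu>' \<noteq> \<mu>''
        \<and> weak_conv_m (\<lambda>k. normalized_law M T f (n' k)) \<mu>'
        \<and> weak_conv_m (\<lambda>k. normalized_law M T f (n'' k)) \<mu>'')"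
proof -
  obtain m where m: "\<And>k. 0 < m k" "\<And>k. m k \<le> m (Suc k)"
    "\<And>k Q. real (sd k) * (\<Sum>i<Q. c (Suc i) * block_weight (m k) i) \<le> (1 / 2) ^ k"
    "\<And>k. real (long_time k (m k)) * (real (sd (Suc k)) / sqrt (real (m (Suc k)))) \<le> (1 / 2) ^ Suc k"
    using exists_scales[OF assms] by blast
  define p where "p k = (real k + 1) / real (long_time k (m k))" for k
  \<comment> \<open>In the type \<open>int \<Rightarrow> nat \<Rightarrow> real\<close> the outer
    index is time and the inner one numbers the components.\<close>
  define N where "N = PiM UNIV (\<lambda>k. three_point (p k))"
  note constr = superposition_three_point[OF m(1,4), folded p_def N_def]
  interpret superposition N "\<lambda>k y. y k" "\<lambda>k. real (sd k)" m
    by (rule constr)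
  interpret counterexample N m c p
    by unfold_locales (use assms(1) m constr in \<open>simp_all add: p_def\<close>)
  have n1: "1 \<le> short (k + 5)" "1 \<le> long (k + 5)" for k
    using short_time_pos[OF m_pos[of "k + 5"], of "k + 5"] short_le_long[of "k + 5" "m (k + 5)"]
    by linarith+
  have pos: "0 < L2_norm M (birkhoff_sum T f (short (k + 5)))" "0 < L2_norm M (birkhoff_sum T f (long (k + 5)))" for k
    by (rule L2_norm_birkhoff_sum_pos; use short_le_long in auto)+
  have rd: "real_distribution (return borel (0::real))" "real_distribution std_normal_distribution"
    by (simp add: real_distribution_def real_distribution_axioms_def prob_space_return)
      (rule real_dist_normal_dist)
  show ?thesis
  proof (intro exI conjI allI impI)
    show "ergodic_dynamical_system M T" by (rule D.ergodic_dynamical_system_axioms)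
    show "integrable M (\<lambda>x. (f x)\<^sup>2)" using square_integrable_f by (simp add: square_integrable_def)
    show "sets (past i) \<subseteq> sets (past j)" if "i \<le> j" for i j using that by (rule past_mono)
    show "weak_conv_m (\<lambda>k. normalized_law M T f (short (k + 5))) (return borel 0)"
      by (rule weak_conv_short)
    show "weak_conv_m (\<lambda>k. normalized_law M T f (long (k + 5))) std_normal_distribution"
      by (rule weak_conv_long)
  qed (fact subalgebra_past vimage_T_past f_past integral_f summable_cond_exp strict_mono_short
      strict_mono_long n1 pos rd return_neq_std_normal)+
qed

end
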